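(* For any $\varepsilon>0$ there exists $\gamma>0$ such that for all sufficiently large $t$ (depending on $\varepsilon$) and all sufficiently large $N$ (depending on $t,\varepsilon$), $$\mathbb{P}\left(\max_{0\le s\le t}\frac{T_N(s)-4N+s^22^{4/3}N^{1/3}}{2^{4/3}N^{1/3}(\log t)^{2/3}}\ge\left(\frac34\right)^{2/3}(1+\varepsilon)\right)\le t^{-\gamma}.$$
   Context: Put i.i.d. $\mathrm{Exp}(1)$ weights on the vertices of $\mathbb{Z}^2$. For $s\in\mathbb{R}$ and $N\in\mathbb{N}$ let $u_N(s)=(N-\lfloor s(2N)^{2/3}\rfloor,\,N+\lfloor s(2N)^{2/3}\rfloor)\in\mathbb{Z}^2$. Let $T_N(s)$ be the last passage time from $(0,0)$ to $u_N(s)$, i.e. the maximal total weight (excluding the weight of the last vertex) of an up/right lattice path from $(0,0)$ to $u_N(s)$. Maxima over the real parameter $s$ are to be read as suprema. *)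

theory Defs
  imports "HOL-Probability.Probability"
begin

definition up_right_step :: "int \<times> int \<Rightarrow> int \<times> int \<Rightarrow> bool" where
  "up_right_step v w \<longleftrightarrow> w = (fst v + 1, snd v) \<or> w = (fst v, snd v + 1)"

definition up_right_paths :: "int \<times> int \<Rightarrow> int \<times> int \<Rightarrow> (int \<times> int) list set" where
  "up_right_paths u v = {p. p \<noteq> [] \<and> hd p = u \<and> last p = v \<and> successively up_right_step p}"

text \<open>The weight of the last vertex of a path is not counted.\<close>

definition path_weight :: "(int \<times> int \<Rightarrow> real) \<Rightarrow> (int \<times> int) list \<Rightarrow> real" where
  "path_weight w p = (\<Sum>v\<leftarrow>butlast p. w v)"

text \<open>
  There are only finitely many paths between two given points. If the second point is not
  coordinatewise above the first there are none, and the value below is unspecified.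
\<close>

definition last_passage_time ::
    "(int \<times> int \<Rightarrow> real) \<Rightarrow> int \<times> int \<Rightarrow> int \<times> int \<Rightarrow> real" where
  "last_passage_time w u v = Max (path_weight w ` up_right_paths u v)"

definition lpp_endpoint :: "nat \<Rightarrow> real \<Rightarrow> int \<times> int" where
  "lpp_endpoint N s =
     (int N - \<lfloor>s * (2 * real N) powr (2/3)\<rfloor>, int N + \<lfloor>s * (2 * real N) powr (2/3)\<rfloor>)"

text \<open>
  For \<open>0 \<le> s \<le> t\<close> the endpoint lies in the first quadrant as soon as \<open>N\<close> is large depending
  on \<open>t\<close>, so the unspecified case of \<open>last_passage_time\<close> does not occur in that regime.
\<close>

definition lpp_T :: "(int \<times> int \<Rightarrow> real) \<Rightarrow> nat \<Rightarrow> real \<Rightarrow> real" where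
  "lpp_T w N s = last_passage_time w (0, 0) (lpp_endpoint N s)"

definition iid_exp1_weights :: "'a measure \<Rightarrow> (int \<times> int \<Rightarrow> 'a \<Rightarrow> real) \<Rightarrow> bool" where
  "iid_exp1_weights M X \<longleftrightarrow>
     prob_space.indep_vars M (\<lambda>_. borel) X UNIV \<and>
     (\<forall>v. distributed M lborel (X v) (exponential_density 1))"

end

theory Submission
  imports Defs "HOL-Real_Asymp.Real_Asymp"
begin

text \<open>
  The proof is an exponential Chernoff bound through a last passage model with boundary weights, for
  which the exponential moments are explicit. Put independent weights \<open>H i\<close> of law \<open>Exp z\<close> on a
  horizontal axis and \<open>V j\<close> of law \<open>Exp (1 - z)\<close> on a vertical axis next to the bulk weights. The
  passage time \<open>G\<close> with boundary dominates the bulk passage time, and by Burke's property the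
  increments of \<open>G\<close> along any down-right lattice path are again independent, with law \<open>Exp z\<close> on
  horizontal and \<open>Exp (1 - z)\<close> on vertical steps.

  Let \<open>\<eta> > 0\<close>. The bulk is independent of the axis, so that
  \<open>E exp (\<eta> T) * E exp (- \<eta> \<Sum> H) = E exp (\<eta> T - \<eta> \<Sum> H) \<le> E exp (\<eta> G - \<eta> \<Sum> H)\<close>, and
  \<open>G - \<Sum> H\<close> is the sum of the vertical increments along the right side of the rectangle. Both
  outer expectations are thus products, and for the corner of an \<open>m \<times> n\<close> rectangle this gives
  \<open>E exp (\<eta> T) \<le> ((z + \<eta>) / z)^m ((1 - z) / (1 - z - \<eta>))^n\<close>. Near the diagonal, with \<open>\<eta>\<close> of order
  \<open>N powr (-1/3)\<close> and \<open>z\<close> chosen along the characteristic direction, the bound has the sharp upper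
  tail rate \<open>4/3 * y powr (3/2)\<close>.

  The same identity controls a whole block of end points on an antidiagonal: from the corner one
  continues the path as a staircase, whose steps are independent, so that \<open>exp (\<eta> G)\<close> along the block is
  \<open>exp (\<eta> G)\<close> at the corner times a product of independent factors. The expected running maximum of
  such a product, normalised by second moments, is at most 2 (\<open>nn_integral_running_max\<close>). The resulting
  estimate is \<open>exp_moment_max_last_passage_time\<close>. For blocks of length about \<open>(2 * N) powr (2/3)\<close>, that is,
  of length 1 in the parameter \<open>s\<close>, the normalisation and the curvature of the parabola within the
  block cost only a factor \<open>exp (O ((ln t) powr (2/3)))\<close> when \<open>y\<close> is of order \<open>(ln t) powr (2/3)\<close>; this is
  smaller than any positive power of \<open>t\<close>.

  The value \<open>y = (3/4) powr (2/3) * (ln t) powr (2/3)\<close> is the one for which \<open>4/3 * y powr (3/2) = ln t\<close>.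
  The factor \<open>1 + \<epsilon>\<close> makes the probability for one block smaller than a power of \<open>t\<close> with exponent less
  than \<open>-1\<close>, and at most \<open>t + 1\<close> blocks cover the range \<open>0 \<le> s \<le> t\<close>.
\<close>

section \<open>Exponential laws and Burke's property\<close>

abbreviation expo :: "real \<Rightarrow> real measure" where
  "expo l \<equiv> density lborel (\<lambda>x. ennreal (exponential_density l x))"

lemma nn_integral_expo:
  assumes [measurable]: "f \<in> borel_measurable borel"
  shows "(\<integral>\<^sup>+x. f x \<partial>expo l) = (\<integral>\<^sup>+x. ennreal (exponential_density l x) * f x \<partial>lborel)"
  by (subst nn_integral_density) auto

lemma nn_integral_exponential_density:
  assumes "0 < l"
  shows "(\<integral>\<^sup>+x. ennreal (exponential_density l x) \<partial>lborel) = 1"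
proof -
  interpret prob_space "expo l" by (rule prob_space_exponential_density[OF assms])
  have "emeasure (expo l) (space (expo l)) = 1" by (rule emeasure_space_1)
  then show ?thesis by (subst (asm) emeasure_density) auto
qed

lemma expo_mgf:
  assumes "0 < l" "\<theta> < l"
  shows "(\<integral>\<^sup>+x. ennreal (exp (\<theta> * x)) \<partial>expo l) = ennreal (l / (l - \<theta>))"
proof -
  have "(\<integral>\<^sup>+x. ennreal (exp (\<theta> * x)) \<partial>expo l)
      = (\<integral>\<^sup>+x. ennreal (exponential_density l x) * ennreal (exp (\<theta> * x)) \<partial>lborel)"
    by (rule nn_integral_expo) measurable
  also have "\<dots> = (\<integral>\<^sup>+x. ennreal (l / (l - \<theta>)) * ennreal (exponential_density (l - \<theta>) x) \<partial>lborel)"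
    using assms
    by (intro nn_integral_cong)
      (auto simp: exponential_density_def ennreal_mult[symmetric] exp_diff exp_minus field_simps simp flip: exp_add)
  also have "\<dots> = ennreal (l / (l - \<theta>))"
    using assms by (subst nn_integral_cmult) (auto simp: nn_integral_exponential_density)
  finally show ?thesis .
qed

lemma AE_expo_nonneg: "AE x in expo l. 0 \<le> x"
  by (subst AE_density) (auto simp: exponential_density_def)

lemma nn_integral_lborel_shift:
  fixes f :: "real \<Rightarrow> ennreal"
  assumes "f \<in> borel_measurable borel"
  shows "(\<integral>\<^sup>+x. f x \<partial>lborel) = (\<integral>\<^sup>+d. f (v + d) \<partial>lborel)"
  using nn_integral_real_affine[OF assms, of 1 v] by simp

text \<open>
  Since the rates add up to 1, the joint density of two exponential variables depends on the smaller
  one only through a rate 1 density, once the difference is fixed.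
\<close>

lemma exponential_density_shift:
  assumes "0 < p" "0 < q" "p + q = 1" "0 \<le> v" "0 \<le> d"
  shows "ennreal (exponential_density p (v + d)) * ennreal (exponential_density q v)
       = ennreal (p * q * exp (- p * d)) * ennreal (exponential_density 1 v)"
proof -
  have q: "q = 1 - p" using assms by simp
  have "exponential_density p (v + d) * exponential_density q v
      = p * q * (exp (- (v + d) * p) * exp (- v * q))"
    using assms by (simp add: exponential_density_def)
  also have "exp (- (v + d) * p) * exp (- v * q) = exp (- p * d) * exp (- v)"
    unfolding q by (simp add: algebra_simps flip: exp_add)
  also have "p * q * (exp (- p * d) * exp (- v)) = p * q * exp (- p * d) * exponential_density 1 v"
    using assms by (simp add: exponential_density_def)
  finally show ?thesis
    using assms by (simp flip: ennreal_mult add: exponential_density_def)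
qed

text \<open>
  The part of Burke's property where the horizontal weight is the larger one; the function \<open>b\<close> stands for
  the indicator of \<open>h - v \<ge> 0\<close> or of \<open>h - v > 0\<close>. In the coordinates \<open>d = h - v\<close> and \<open>v\<close> the density
  factorises, and \<open>v\<close>, which then occurs in the density only, integrates to 1. The fresh weight \<open>a\<close>
  has the same rate 1 law as \<open>v\<close> and takes its place.
\<close>

lemma burke_half:
  fixes f :: "real \<Rightarrow> real \<Rightarrow> ennreal" and b :: "real \<Rightarrow> ennreal"
  assumes [measurable]: "case_prod f \<in> borel_measurable (borel \<Otimes>\<^sub>M borel)" "b \<in> borel_measurable borel"
    and b: "\<And>d. d < 0 \<Longrightarrow> b d = 0"
    and p: "0 < p" "0 < q" "p + q = 1"
  shows "(\<integral>\<^sup>+v. (\<integral>\<^sup>+h. (\<integral>\<^sup>+a. b (h - v) * (ennreal (exponential_density p h) *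
            ennreal (exponential_density q v) * ennreal (exponential_density 1 a)) *
            f (a + (h - v)) a \<partial>lborel) \<partial>lborel) \<partial>lborel)
       = (\<integral>\<^sup>+v. (\<integral>\<^sup>+h. b (h - v) * (ennreal (exponential_density p h) *
            ennreal (exponential_density q v)) * f h v \<partial>lborel) \<partial>lborel)"
    (is "?L = ?R")
proof -
  define k where "k d a = b d * ennreal (p * q * exp (- p * d)) *
      ennreal (exponential_density 1 a) * f (a + d) a" for d a :: real
  have [measurable]: "case_prod k \<in> borel_measurable (borel \<Otimes>\<^sub>M borel)"
    unfolding k_def by measurable
  have shift: "b d * (ennreal (exponential_density p (v + d)) * ennreal (exponential_density q v))
      = b d * (ennreal (p * q * exp (- p * d)) * ennreal (exponential_density 1 v))" for v d
  proof (cases "0 \<le> v \<and> 0 \<le> d")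
    case True
    then show ?thesis using exponential_density_shift[of p q v d] p by simp
  next
    case False
    then show ?thesis using b[of d] by (auto simp: exponential_density_def)
  qed
  have "?L = (\<integral>\<^sup>+v. (\<integral>\<^sup>+d. (\<integral>\<^sup>+a. b (v + d - v) * (ennreal (exponential_density p (v + d)) *
            ennreal (exponential_density q v) * ennreal (exponential_density 1 a)) *
            f (a + (v + d - v)) a \<partial>lborel) \<partial>lborel) \<partial>lborel)"
    by (rule nn_integral_cong, rule nn_integral_lborel_shift) measurable
  also have "\<dots> = (\<integral>\<^sup>+v. (\<integral>\<^sup>+d. (\<integral>\<^sup>+a. ennreal (exponential_density 1 v) * k d a \<partial>lborel) \<partial>lborel) \<partial>lborel)"
  proof (intro nn_integral_cong, goal_cases)
    case (1 v d a)
    show ?case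
      using arg_cong[OF shift[of d v], of "\<lambda>x. x * ennreal (exponential_density 1 a) * f (a + d) a"]
      by (simp add: k_def mult_ac)
  qed
  also have "\<dots> = (\<integral>\<^sup>+d. (\<integral>\<^sup>+a. k d a \<partial>lborel) \<partial>lborel)"
    by (simp add: nn_integral_cmult nn_integral_multc nn_integral_exponential_density)
  also have "\<dots> = (\<integral>\<^sup>+v. (\<integral>\<^sup>+d. k d v \<partial>lborel) \<partial>lborel)"
    by (rule lborel_pair.Fubini'[symmetric]) measurable
  also have "\<dots> = (\<integral>\<^sup>+v. (\<integral>\<^sup>+d. b (v + d - v) * (ennreal (exponential_density p (v + d)) *
            ennreal (exponential_density q v)) * f (v + d) v \<partial>lborel) \<partial>lborel)"
  proof (intro nn_integral_cong, goal_cases)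
    case (1 v d)
    show ?case
      using arg_cong[OF shift[of d v], of "\<lambda>x. x * f (v + d) v"] by (simp add: k_def mult_ac)
  qed
  also have "\<dots> = ?R"
    by (rule nn_integral_cong, rule nn_integral_lborel_shift[symmetric]) measurable
  finally show ?thesis .
qed

text \<open>
  Burke's property for one cell. If \<open>h\<close> and \<open>v\<close> are the increments of the passage time along the lower
  and the left side of a cell with weight \<open>a\<close>, then \<open>a + max 0 (h - v)\<close> and \<open>a + max 0 (v - h)\<close> are
  the increments along its upper and right side. They have the same joint law as \<open>h\<close> and \<open>v\<close>. The
  proof splits according to the sign of \<open>h - v\<close>; the two cases are mirror images of each other.
\<close>

proposition burke:
  fixes f :: "real \<Rightarrow> real \<Rightarrow> ennreal"
  assumes [measurable]: "case_prod f \<in> borel_measurable (borel \<Otimes>\<^sub>M borel)"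
    and p: "0 < p" "0 < q" "p + q = 1"
  shows "(\<integral>\<^sup>+v. (\<integral>\<^sup>+h. (\<integral>\<^sup>+a. f (a + max 0 (h - v)) (a + max 0 (v - h)) \<partial>expo 1) \<partial>expo p) \<partial>expo q)
       = (\<integral>\<^sup>+v. (\<integral>\<^sup>+h. f h v \<partial>expo p) \<partial>expo q)"
    (is "?L = ?R")
proof -
  define D where "D l x = ennreal (exponential_density l x)" for l x :: real
  have [measurable]: "D l \<in> borel_measurable borel" for l
    unfolding D_def by measurable
  define b1 b2 :: "real \<Rightarrow> ennreal" where "b1 = indicator {0::real..}" and "b2 = indicator {0::real<..}"
  have [measurable]: "b1 \<in> borel_measurable borel" "b2 \<in> borel_measurable borel"
    unfolding b1_def b2_def by measurable
  have expo: "(\<integral>\<^sup>+x. g x \<partial>expo l) = (\<integral>\<^sup>+x. D l x * g x \<partial>lborel)"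
    if "g \<in> borel_measurable borel" for g :: "real \<Rightarrow> ennreal" and l
    using nn_integral_expo[OF that] unfolding D_def .
  have part: "b1 (h - v) + b2 (v - h) = (1 :: ennreal)" for h v
    by (auto simp: b1_def b2_def indicator_def)
  have "?L = (\<integral>\<^sup>+v. (\<integral>\<^sup>+h. (\<integral>\<^sup>+a. D q v * (D p h * (D 1 a *
                f (a + max 0 (h - v)) (a + max 0 (v - h)))) \<partial>lborel) \<partial>lborel) \<partial>lborel)"
    by (simp add: expo nn_integral_cmult cong: nn_integral_cong)
  also have "\<dots> = (\<integral>\<^sup>+v. (\<integral>\<^sup>+h. (\<integral>\<^sup>+a. b1 (h - v) * (D p h * D q v * D 1 a) * f (a + (h - v)) a
        + b2 (v - h) * (D q v * D p h * D 1 a) * f a (a + (v - h)) \<partial>lborel) \<partial>lborel) \<partial>lborel)"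
  proof (intro nn_integral_cong, goal_cases)
    case (1 v h a)
    then show ?case
      by (cases "v \<le> h") (auto simp: b1_def b2_def indicator_def max_def mult_ac)
  qed
  also have "\<dots> = (\<integral>\<^sup>+v. (\<integral>\<^sup>+h. (\<integral>\<^sup>+a. b1 (h - v) * (D p h * D q v * D 1 a) * f (a + (h - v)) a \<partial>lborel) \<partial>lborel) \<partial>lborel)
      + (\<integral>\<^sup>+v. (\<integral>\<^sup>+h. (\<integral>\<^sup>+a. b2 (v - h) * (D q v * D p h * D 1 a) * f a (a + (v - h)) \<partial>lborel) \<partial>lborel) \<partial>lborel)"
    by (simp add: nn_integral_add)
  also have "(\<integral>\<^sup>+v. (\<integral>\<^sup>+h. (\<integral>\<^sup>+a. b1 (h - v) * (D p h * D q v * D 1 a) * f (a + (h - v)) a \<partial>lborel) \<partial>lborel) \<partial>lborel)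
      = (\<integral>\<^sup>+v. (\<integral>\<^sup>+h. b1 (h - v) * (D p h * D q v) * f h v \<partial>lborel) \<partial>lborel)"
    unfolding D_def using p by (intro burke_half) (auto simp: b1_def)
  also have "(\<integral>\<^sup>+v. (\<integral>\<^sup>+h. (\<integral>\<^sup>+a. b2 (v - h) * (D q v * D p h * D 1 a) * f a (a + (v - h)) \<partial>lborel) \<partial>lborel) \<partial>lborel)
      = (\<integral>\<^sup>+h. (\<integral>\<^sup>+v. (\<integral>\<^sup>+a. b2 (v - h) * (D q v * D p h * D 1 a) * f a (a + (v - h)) \<partial>lborel) \<partial>lborel) \<partial>lborel)"
    by (rule lborel_pair.Fubini'[symmetric]) measurable
  also have "\<dots> = (\<integral>\<^sup>+h. (\<integral>\<^sup>+v. b2 (v - h) * (D q v * D p h) * f h v \<partial>lborel) \<partial>lborel)"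
    unfolding D_def using p by (intro burke_half[where f = "\<lambda>x y. f y x"]) (auto simp: b2_def)
  also have "\<dots> = (\<integral>\<^sup>+v. (\<integral>\<^sup>+h. b2 (v - h) * (D q v * D p h) * f h v \<partial>lborel) \<partial>lborel)"
    by (rule lborel_pair.Fubini') measurable
  also have "(\<integral>\<^sup>+v. (\<integral>\<^sup>+h. b1 (h - v) * (D p h * D q v) * f h v \<partial>lborel) \<partial>lborel) + \<dots>
      = (\<integral>\<^sup>+v. (\<integral>\<^sup>+h. (b1 (h - v) + b2 (v - h)) * (D q v * (D p h * f h v)) \<partial>lborel) \<partial>lborel)"
    by (simp add: nn_integral_add distrib_left distrib_right mult_ac)
  also have "\<dots> = ?R"
    unfolding part by (simp add: expo nn_integral_cmult cong: nn_integral_cong)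
  finally show ?thesis .
qed

section \<open>Last passage with boundary and corner flips\<close>

text \<open>
  Passage times are attached to the corners of the cells: the bulk weights that enter
  \<open>bdry_lpp H V w i j\<close> are those of the cells \<open>(i', j')\<close> with \<open>i' < i\<close> and \<open>j' < j\<close>. The index 0 is the axis.
\<close>

fun bdry_lpp :: "(nat \<Rightarrow> real) \<Rightarrow> (nat \<Rightarrow> real) \<Rightarrow> (nat \<times> nat \<Rightarrow> real) \<Rightarrow> nat \<Rightarrow> nat \<Rightarrow> real" where
  "bdry_lpp H V w 0 0 = 0"
| "bdry_lpp H V w (Suc i) 0 = bdry_lpp H V w i 0 + H i"
| "bdry_lpp H V w 0 (Suc j) = bdry_lpp H V w 0 j + V j"
| "bdry_lpp H V w (Suc i) (Suc j) =
     w (i, j) + max (bdry_lpp H V w i (Suc j)) (bdry_lpp H V w (Suc i) j)"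

text \<open>
  A down-right path through the grid crosses every column in one horizontal edge and every row in one
  vertical edge. Its increments can therefore be stored at the fixed index set of columns \<open>Inl i\<close> and
  rows \<open>Inr j\<close>, whatever the path. Pushing the path over the cell \<open>(i, j)\<close> changes only the entries of
  column \<open>i\<close> and row \<open>j\<close>.
\<close>

definition flip :: "real \<Rightarrow> nat \<Rightarrow> nat \<Rightarrow> (nat + nat \<Rightarrow> real) \<Rightarrow> (nat + nat \<Rightarrow> real)" where
  "flip a i j x = x(Inl i := a + max 0 (x (Inl i) - x (Inr j)),
                    Inr j := a + max 0 (x (Inr j) - x (Inl i)))"

definition flips :: "(nat \<times> nat \<Rightarrow> real) \<Rightarrow> (nat \<times> nat) list \<Rightarrow> (nat + nat \<Rightarrow> real) \<Rightarrow> (nat + nat \<Rightarrow> real)" where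
  "flips w cs = fold (\<lambda>c. flip (w c) (fst c) (snd c)) cs"

text \<open>
  Number of cells of row \<open>j\<close> below the final path: all \<open>m\<close> columns in the rows \<open>j < n\<close>, then
  one column less in each further row.
\<close>

definition row_width :: "nat \<Rightarrow> nat \<Rightarrow> nat \<Rightarrow> nat" where
  "row_width m n j = min m (n + m - 1 - j)"

definition cells :: "nat \<Rightarrow> nat \<Rightarrow> nat \<Rightarrow> (nat \<times> nat) list" where
  "cells m n r = concat (map (\<lambda>j. map (\<lambda>i. (i, j)) [0..<row_width m n j]) [0..<r])"

lemma distinct_cells: "distinct (cells m n r)"
  unfolding cells_def
  by (induction r) (auto simp: distinct_map inj_on_def)

lemma set_cells: "set (cells m n r) = {(i, j). j < r \<and> i < row_width m n j}"
  unfolding cells_def by auto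

lemma bdry_lpp_axis_h: "bdry_lpp H V w i 0 = (\<Sum>i'<i. H i')"
  by (induction i) auto

text \<open>
  The recursion of \<open>bdry_lpp\<close>, written in increments, is exactly one flip. Pushing the path over the
  first \<open>k\<close> cells of row \<open>j\<close> therefore moves the increments of these columns one level up and carries the
  increment of row \<open>j\<close> from the axis to column \<open>k\<close>.
\<close>

lemma flips_row:
  fixes H V w
  defines "G \<equiv> bdry_lpp H V w"
  assumes "\<And>i. i < k \<Longrightarrow> x (Inl i) = G (Suc i) j - G i j"
    and "x (Inr j) = G 0 (Suc j) - G 0 j"
  shows "flips w (map (\<lambda>i. (i, j)) [0..<k]) x =
    (\<lambda>e. case e of
       Inl i \<Rightarrow> if i < k then G (Suc i) (Suc j) - G i (Suc j) else x (Inl i)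
     | Inr j' \<Rightarrow> if j' = j then G k (Suc j) - G k j else x (Inr j'))"
  using assms(2)
proof (induction k)
  case 0
  show ?case
    using assms(3) by (auto simp: flips_def fun_eq_iff split: sum.splits)
next
  case (Suc k)
  have IH: "flips w (map (\<lambda>i. (i, j)) [0..<k]) x =
    (\<lambda>e. case e of
       Inl i \<Rightarrow> if i < k then G (Suc i) (Suc j) - G i (Suc j) else x (Inl i)
     | Inr j' \<Rightarrow> if j' = j then G k (Suc j) - G k j else x (Inr j'))"
    using Suc.prems by (intro Suc.IH) auto
  have x: "x (Inl k) = G (Suc k) j - G k j" by (rule Suc.prems) simp
  have G: "G (Suc k) (Suc j) = w (k, j) + max (G k (Suc j)) (G (Suc k) j)"
    by (simp add: G_def)
  have "flips w (map (\<lambda>i. (i, j)) [0..<Suc k]) x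
      = flip (w (k, j)) k j (flips w (map (\<lambda>i. (i, j)) [0..<k]) x)"
    by (simp add: flips_def)
  then show ?case
    unfolding IH by (auto simp: fun_eq_iff flip_def x G max_def split: sum.splits)
qed

text \<open>
  The number \<open>h r i\<close> counts the cells of column \<open>i\<close> in the first \<open>r\<close> rows, hence is the height at
  which the current path crosses column \<open>i\<close>.
\<close>

lemma flips_cells:
  fixes H V w and m n :: nat
  defines "G \<equiv> bdry_lpp H V w"
  assumes x: "x = case_sum H V"
  defines "h \<equiv> \<lambda>r i. min r (n + m - 1 - i)"
  shows "flips w (cells m n r) x =
    (\<lambda>e. case e of
       Inl i \<Rightarrow> if i < m then G (Suc i) (h r i) - G i (h r i) else H i
     | Inr j \<Rightarrow> if j < r then G (row_width m n j) (Suc j) - G (row_width m n j) j else V j)"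
proof (induction r)
  case 0
  show ?case
    by (auto simp: x cells_def flips_def G_def h_def split: sum.splits)
next
  case (Suc r)
  have inside: "i < m" "h r i = r" "h (Suc r) i = Suc r" if "i < row_width m n r" for i
    using that by (auto simp: row_width_def h_def)
  have outside: "h (Suc r) i = h r i" if "\<not> i < row_width m n r" "i < m" for i
    using that by (auto simp: row_width_def h_def)
  have "flips w (cells m n (Suc r)) x
      = flips w (map (\<lambda>i. (i, r)) [0..<row_width m n r]) (flips w (cells m n r) x)"
    by (simp add: flips_def cells_def)
  also have "\<dots> = (\<lambda>e. case e of
       Inl i \<Rightarrow> if i < row_width m n r then G (Suc i) (Suc r) - G i (Suc r)
                else flips w (cells m n r) x (Inl i)
     | Inr j' \<Rightarrow> if j' = r then G (row_width m n r) (Suc r) - G (row_width m n r) r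
                else flips w (cells m n r) x (Inr j'))"
    unfolding G_def
    by (rule flips_row) (auto simp: Suc.IH inside G_def)
  also have "\<dots> = (\<lambda>e. case e of
       Inl i \<Rightarrow> if i < m then G (Suc i) (h (Suc r) i) - G i (h (Suc r) i) else H i
     | Inr j \<Rightarrow> if j < Suc r then G (row_width m n j) (Suc j) - G (row_width m n j) j else V j)"
    unfolding Suc.IH
    by (intro ext) (auto simp: inside outside split: sum.splits)
  finally show ?case .
qed

text \<open>
  The final path goes up from \<open>(m, 0)\<close> to \<open>(m, n)\<close> and then takes steps left and up in turn. Adding its
  increments yields the passage time at every second point of the staircase. The horizontal axis enters
  only through its sum; everything else is a function of the final increments.
\<close>

lemma bdry_lpp_staircase:
  fixes H V w and m n K l :: nat
  assumes x: "x = case_sum H V" and "K \<le> m" "l \<le> K"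
  defines "y \<equiv> flips w (cells m n (n + K)) x"
  shows "bdry_lpp H V w (m - l) (n + l) =
    (\<Sum>i<m. H i) + (\<Sum>j<n. y (Inr j)) + (\<Sum>k<l. y (Inr (n + k)) - y (Inl (m - 1 - k)))"
proof -
  define G where "G = bdry_lpp H V w"
  note y = y_def[unfolded flips_cells[OF x], folded G_def]
  have col: "G m r = (\<Sum>i<m. H i) + (\<Sum>j<r. y (Inr j))" if "r \<le> n" for r
    using that
  proof (induction r)
    case 0
    show ?case by (simp add: G_def bdry_lpp_axis_h)
  next
    case (Suc r)
    have "row_width m n r = m" using Suc.prems by (auto simp: row_width_def)
    then have "y (Inr r) = G m (Suc r) - G m r"
      using Suc.prems by (simp add: y)
    then show ?case using Suc by simp
  qed
  have "G (m - l) (n + l) = G m n + (\<Sum>k<l. y (Inr (n + k)) - y (Inl (m - 1 - k)))"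
    using \<open>l \<le> K\<close>
  proof (induction l)
    case 0
    show ?case by simp
  next
    case (Suc l)
    have i: "m - 1 - l < m" "Suc (m - 1 - l) = m - l" "m - 1 - l = m - Suc l"
      using Suc.prems \<open>K \<le> m\<close> by auto
    have h: "min (n + K) (n + m - 1 - (m - Suc l)) = n + l"
      using Suc.prems \<open>K \<le> m\<close> by auto
    have "row_width m n (n + l) = m - Suc l"
      by (auto simp: row_width_def)
    then have "y (Inr (n + l)) = G (m - Suc l) (Suc (n + l)) - G (m - Suc l) (n + l)"
      using Suc.prems by (simp add: y)
    moreover have "y (Inl (m - 1 - l)) = G (m - l) (n + l) - G (m - Suc l) (n + l)"
      using i h by (simp add: y)
    moreover have "G (m - l) (n + l) = G m n + (\<Sum>k<l. y (Inr (n + k)) - y (Inl (m - 1 - k)))"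
      using Suc by simp
    ultimately show ?case by simp
  qed
  then show ?thesis by (simp add: col G_def[symmetric])
qed

section \<open>Lattice paths and their passage times\<close>

lemma up_right_path_props:
  assumes "p \<noteq> []" "successively up_right_step p"
  shows "v \<in> set p \<Longrightarrow> fst (hd p) \<le> fst v \<and> snd (hd p) \<le> snd v \<and> fst v \<le> fst (last p) \<and> snd v \<le> snd (last p)"
    and "int (length p) = fst (last p) - fst (hd p) + (snd (last p) - snd (hd p)) + 1"
proof -
  have "(\<forall>v\<in>set p. fst (hd p) \<le> fst v \<and> snd (hd p) \<le> snd v \<and> fst v \<le> fst (last p) \<and> snd v \<le> snd (last p)) \<and>
     int (length p) = fst (last p) - fst (hd p) + (snd (last p) - snd (hd p)) + 1"
    using assms
  proof (induction p rule: list_nonempty_induct)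
    case (single u)
    show ?case by simp
  next
    case (cons u p)
    then have step: "up_right_step u (hd p)" and succ: "successively up_right_step p"
      by (auto simp: successively_Cons)
    note IH = cons.IH[OF succ]
    have "fst u \<le> fst (hd p)" "snd u \<le> snd (hd p)"
        "fst (hd p) + snd (hd p) = fst u + snd u + 1"
      using step by (auto simp: up_right_step_def)
    moreover have "fst (hd p) \<le> fst (last p)" "snd (hd p) \<le> snd (last p)"
      using IH cons.hyps by (auto dest: bspec[OF _ last_in_set])
    ultimately show ?case
      using IH cons.hyps by (auto intro: order_trans)
  qed
  then show "v \<in> set p \<Longrightarrow> fst (hd p) \<le> fst v \<and> snd (hd p) \<le> snd v \<and> fst v \<le> fst (last p) \<and> snd v \<le> snd (last p)"
    and "int (length p) = fst (last p) - fst (hd p) + (snd (last p) - snd (hd p)) + 1"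
    by auto
qed

lemma finite_up_right_paths: "finite (up_right_paths u v)"
proof (rule finite_subset)
  let ?B = "{fst u..fst v} \<times> {snd u..snd v}"
  let ?n = "nat (fst v - fst u + (snd v - snd u) + 1)"
  show "up_right_paths u v \<subseteq> {p. set p \<subseteq> ?B \<and> length p = ?n}"
  proof
    fix p assume "p \<in> up_right_paths u v"
    then have p: "p \<noteq> []" "hd p = u" "last p = v" "successively up_right_step p"
      by (auto simp: up_right_paths_def)
    have "set p \<subseteq> ?B"
      using up_right_path_props(1)[OF p(1,4)] p(2,3) by (auto simp: mem_Times_iff)
    moreover have "length p = ?n"
      using up_right_path_props(2)[OF p(1,4)] p(2,3) by simp
    ultimately show "p \<in> {p. set p \<subseteq> ?B \<and> length p = ?n}" by blast
  qed
  show "finite {p. set p \<subseteq> ?B \<and> length p = ?n}"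
    by (rule finite_lists_length_eq) simp
qed

lemma up_right_paths_nonempty: "up_right_paths (0, 0) (int a, int b) \<noteq> {}"
proof -
  have "\<exists>p. p \<in> up_right_paths (0, 0) (int a, 0)"
  proof (induction a)
    case 0
    show ?case by (intro exI[of _ "[(0, 0)]"]) (simp add: up_right_paths_def)
  next
    case (Suc a)
    then obtain p where "p \<in> up_right_paths (0, 0) (int a, 0)" by blast
    then have "p @ [(int (Suc a), 0)] \<in> up_right_paths (0, 0) (int (Suc a), 0)"
      by (auto simp: up_right_paths_def successively_append_iff up_right_step_def)
    then show ?case by blast
  qed
  then have "\<exists>p. p \<in> up_right_paths (0, 0) (int a, int b)"
  proof (induction b)
    case 0
    then show ?case by simp
  next
    case (Suc b)
    then obtain p where "p \<in> up_right_paths (0, 0) (int a, int b)" by blast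
    then have "p @ [(int a, int (Suc b))] \<in> up_right_paths (0, 0) (int a, int (Suc b))"
      by (auto simp: up_right_paths_def successively_append_iff up_right_step_def)
    then show ?case by blast
  qed
  then show ?thesis by blast
qed

text \<open>
  A path that starts in the corner can be completed by a step on the axis. Only the first axis weight
  \<open>H 0\<close> is collected then, which is why it has to be nonnegative.
\<close>

lemma path_le_bdry_lpp:
  fixes w :: "nat \<times> nat \<Rightarrow> real"
  assumes "0 \<le> H 0" "p \<noteq> []" "hd p = (0, 0)" "successively up_right_step p"
  shows "(\<Sum>v\<leftarrow>p. w (nat (fst v), nat (snd v)))
       \<le> bdry_lpp H V w (Suc (nat (fst (last p)))) (Suc (nat (snd (last p))))"
  using assms(2-)
proof (induction p rule: rev_induct)
  case Nil
  then show ?case by simp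
next
  case (snoc u p)
  show ?case
  proof (cases "p = []")
    case True
    then show ?thesis using snoc.prems assms(1) by simp
  next
    case False
    have p: "hd p = (0, 0)" "successively up_right_step p" "up_right_step (last p) u"
      using snoc.prems False by (auto simp: successively_append_iff)
    obtain a b where ab: "last p = (int a, int b)"
    proof (rule that)
      show "last p = (int (nat (fst (last p))), int (nat (snd (last p))))"
        using up_right_path_props(1)[OF False p(2), of "last p"] False p(1)
        by (simp add: prod_eq_iff)
    qed
    have "(\<Sum>v\<leftarrow>p. w (nat (fst v), nat (snd v))) \<le> bdry_lpp H V w (Suc a) (Suc b)"
      using snoc.IH[OF False p(1,2)] ab by simp
    then show ?thesis
      using p(3) ab by (auto simp: up_right_step_def nat_add_distrib)
  qed
qed

text \<open>
  The weight of the last vertex is missing on the left hand side and present on the right hand side.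
\<close>

lemma last_passage_time_le_bdry_lpp:
  fixes w :: "nat \<times> nat \<Rightarrow> real"
  assumes "0 \<le> H 0" "0 \<le> w (a, b)"
  shows "last_passage_time (\<lambda>v. w (nat (fst v), nat (snd v))) (0, 0) (int a, int b)
       \<le> bdry_lpp H V w (Suc a) (Suc b)"
proof -
  have "path_weight (\<lambda>v. w (nat (fst v), nat (snd v))) p \<le> bdry_lpp H V w (Suc a) (Suc b)"
    if "p \<in> up_right_paths (0, 0) (int a, int b)" for p
  proof -
    have p: "p \<noteq> []" "hd p = (0, 0)" "successively up_right_step p" "last p = (int a, int b)"
      using that by (auto simp: up_right_paths_def)
    let ?f = "\<lambda>v. w (nat (fst v), nat (snd v))"
    have "(\<Sum>v\<leftarrow>butlast p @ [last p]. ?f v) = (\<Sum>v\<leftarrow>butlast p. ?f v) + w (a, b)"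
      unfolding map_append sum_list_append by (simp add: p(4))
    then have "(\<Sum>v\<leftarrow>butlast p. ?f v) + w (a, b) = (\<Sum>v\<leftarrow>p. ?f v)"
      unfolding append_butlast_last_id[OF p(1)] by simp
    also have "\<dots> \<le> bdry_lpp H V w (Suc a) (Suc b)"
      using path_le_bdry_lpp[of H p w V] p assms by simp
    finally show ?thesis
      using assms by (simp add: path_weight_def)
  qed
  then show ?thesis
    unfolding last_passage_time_def
    using finite_up_right_paths up_right_paths_nonempty by (subst Max_le_iff) auto
qed

lemma last_passage_time_cong:
  assumes "\<And>i j. 0 \<le> i \<Longrightarrow> i \<le> fst v \<Longrightarrow> 0 \<le> j \<Longrightarrow> j \<le> snd v \<Longrightarrow> w (i, j) = w' (i, j)"
  shows "last_passage_time w (0, 0) v = last_passage_time w' (0, 0) v"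
proof -
  have "path_weight w p = path_weight w' p" if "p \<in> up_right_paths (0, 0) v" for p
  proof -
    have "w u = w' u" if "u \<in> set (butlast p)" for u
      using up_right_path_props(1)[of p u] \<open>p \<in> _\<close> in_set_butlastD[OF that] assms
      by (cases u) (auto simp: up_right_paths_def)
    then show ?thesis unfolding path_weight_def by (intro arg_cong[of _ _ sum_list] map_cong) auto
  qed
  then show ?thesis unfolding last_passage_time_def by (metis (no_types, lifting) image_cong)
qed

section \<open>Invariance of the boundary law\<close>

definition bdry_law :: "real \<Rightarrow> nat + nat \<Rightarrow> real measure" where
  "bdry_law z e = (case e of Inl _ \<Rightarrow> expo z | Inr _ \<Rightarrow> expo (1 - z))"

lemma bdry_law_simps [simp]:
  "bdry_law z (Inl i) = expo z" "bdry_law z (Inr j) = expo (1 - z)"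
  by (simp_all add: bdry_law_def)

lemma sets_bdry_law [measurable_cong, simp]: "sets (bdry_law z e) = sets borel"
  by (cases e) auto

lemma space_bdry_law [simp]: "space (bdry_law z e) = UNIV"
  by (cases e) auto

lemma sets_PiM_bdry_law [measurable_cong]:
  "sets (Pi\<^sub>M S (bdry_law z)) = sets (Pi\<^sub>M S (\<lambda>_. borel))"
  by (intro sets_PiM_cong) auto

lemma sets_PiM_expo [measurable_cong]:
  "sets (Pi\<^sub>M C (\<lambda>_. expo l)) = sets (Pi\<^sub>M C (\<lambda>_. borel))"
  by (intro sets_PiM_cong) auto

lemma product_prob_space_bdry_law:
  assumes "0 < z" "z < 1"
  shows "product_prob_space (bdry_law z)"
  by (rule product_prob_spaceI)
    (use assms in \<open>auto simp: bdry_law_def prob_space_exponential_density split: sum.split\<close>)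

lemma product_prob_space_expo:
  assumes "0 < l"
  shows "product_prob_space (\<lambda>_. expo l)"
  by (rule product_prob_spaceI) (rule prob_space_exponential_density[OF assms])

lemma measurable_flip:
  assumes [measurable]: "f \<in> measurable N (Pi\<^sub>M S (\<lambda>_. borel))" "g \<in> borel_measurable N"
    and S: "Inl i \<in> S" "Inr j \<in> S"
  shows "(\<lambda>x. flip (g x) i j (f x)) \<in> measurable N (Pi\<^sub>M S (\<lambda>_. borel))"
proof -
  have [measurable]: "(\<lambda>x. f x (Inl i)) \<in> borel_measurable N" "(\<lambda>x. f x (Inr j)) \<in> borel_measurable N"
    using measurable_compose[OF assms(1) measurable_component_singleton[OF S(1)]]
      measurable_compose[OF assms(1) measurable_component_singleton[OF S(2)]] by simp_all
  show ?thesis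
    unfolding flip_def
    by (rule measurable_fun_upd[where J = S], use S in blast, rule measurable_fun_upd[where J = S],
        use S in blast, measurable)
qed

lemma measurable_flips:
  assumes "f \<in> measurable N (Pi\<^sub>M S (\<lambda>_. borel))" and [measurable]: "g \<in> measurable N (Pi\<^sub>M C (\<lambda>_. borel))"
    and "set cs \<subseteq> C" "\<And>i j. (i, j) \<in> set cs \<Longrightarrow> Inl i \<in> S \<and> Inr j \<in> S"
  shows "(\<lambda>x. flips (g x) cs (f x)) \<in> measurable N (Pi\<^sub>M S (\<lambda>_. borel))"
  using assms(1,3,4)
proof (induction cs arbitrary: f)
  case Nil
  then show ?case by (simp add: flips_def)
next
  case (Cons c cs)
  have "(\<lambda>x. flip (g x c) (fst c) (snd c) (f x)) \<in> measurable N (Pi\<^sub>M S (\<lambda>_. borel))"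
  proof (rule measurable_flip)
    show "(\<lambda>x. g x c) \<in> borel_measurable N"
      using Cons.prems(2) by (auto intro: measurable_compose[OF assms(2) measurable_component_singleton])
  qed (use Cons.prems(1) Cons.prems(3)[of "fst c" "snd c"] in auto)
  from Cons.IH[OF this] Cons.prems show ?case
    by (simp add: flips_def)
qed

text \<open>
  A flip touches two coordinates of the product measure, so that Fubini reduces the claim to
  Burke's property for a single cell.
\<close>

lemma nn_integral_flip:
  assumes z: "0 < z" "z < 1" and S: "finite S" "Inl i \<in> S" "Inr j \<in> S"
    and F [measurable]: "F \<in> borel_measurable (Pi\<^sub>M S (\<lambda>_. borel))"
  shows "(\<integral>\<^sup>+x. (\<integral>\<^sup>+a. F (flip a i j x) \<partial>expo 1) \<partial>Pi\<^sub>M S (bdry_law z))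
       = (\<integral>\<^sup>+x. F x \<partial>Pi\<^sub>M S (bdry_law z))"
proof -
  interpret product_prob_space "bdry_law z" by (rule product_prob_space_bdry_law[OF z])
  interpret E: prob_space "expo 1" by (rule prob_space_exponential_density) simp
  define S0 where "S0 = S - {Inl i, Inr j}"
  have S_eq: "S = insert (Inl i) (insert (Inr j) S0)" using S by (auto simp: S0_def)
  have S0: "finite S0" "Inr j \<notin> S0" "Inl i \<notin> insert (Inr j) S0" using S by (auto simp: S0_def)
  have split: "(\<integral>\<^sup>+x. G x \<partial>Pi\<^sub>M S (bdry_law z))
     = (\<integral>\<^sup>+x. (\<integral>\<^sup>+v. (\<integral>\<^sup>+h. G (x(Inr j := v, Inl i := h)) \<partial>expo z) \<partial>expo (1 - z)) \<partial>Pi\<^sub>M S0 (bdry_law z))"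
    if [measurable]: "G \<in> borel_measurable (Pi\<^sub>M S (\<lambda>_. borel))" for G
  proof -
    have [measurable]: "G \<in> borel_measurable (Pi\<^sub>M (insert (Inl i) (insert (Inr j) S0)) (bdry_law z))"
      unfolding S_eq[symmetric] by measurable
    have "(\<lambda>(x, h). x(Inl i := h)) \<in> measurable (Pi\<^sub>M (insert (Inr j) S0) (bdry_law z) \<Otimes>\<^sub>M bdry_law z (Inl i))
            (Pi\<^sub>M (insert (Inl i) (insert (Inr j) S0)) (bdry_law z))"
      by (rule measurable_add_dim)
    then have m: "(\<lambda>x. \<integral>\<^sup>+h. G (x(Inl i := h)) \<partial>bdry_law z (Inl i)) \<in> borel_measurable (Pi\<^sub>M (insert (Inr j) S0) (bdry_law z))"
      by measurable
    have "(\<integral>\<^sup>+x. G x \<partial>Pi\<^sub>M S (bdry_law z))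
        = (\<integral>\<^sup>+x. (\<integral>\<^sup>+h. G (x(Inl i := h)) \<partial>bdry_law z (Inl i)) \<partial>Pi\<^sub>M (insert (Inr j) S0) (bdry_law z))"
      unfolding S_eq by (rule product_nn_integral_insert) (use S0 in simp_all)
    also have "\<dots> = (\<integral>\<^sup>+x. (\<integral>\<^sup>+v. (\<integral>\<^sup>+h. G (x(Inr j := v, Inl i := h)) \<partial>bdry_law z (Inl i)) \<partial>bdry_law z (Inr j)) \<partial>Pi\<^sub>M S0 (bdry_law z))"
      by (rule product_nn_integral_insert[OF S0(1,2) m])
    finally show ?thesis by simp
  qed
  have [measurable]: "(\<lambda>x. \<integral>\<^sup>+a. F (flip a i j x) \<partial>expo 1) \<in> borel_measurable (Pi\<^sub>M S (\<lambda>_. borel))"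
  proof -
    have "(\<lambda>p. flip (snd p) i j (fst p)) \<in> measurable (Pi\<^sub>M S (\<lambda>_. borel) \<Otimes>\<^sub>M expo 1) (Pi\<^sub>M S (\<lambda>_. borel))"
      by (intro measurable_flip S) measurable
    then have [measurable]: "(\<lambda>p. F (flip (snd p) i j (fst p))) \<in> borel_measurable (Pi\<^sub>M S (\<lambda>_. borel) \<Otimes>\<^sub>M expo 1)"
      by measurable
    show ?thesis
      by (rule E.borel_measurable_nn_integral) (simp add: case_prod_beta)
  qed
  show ?thesis
    unfolding split[OF \<open>(\<lambda>x. \<integral>\<^sup>+a. F (flip a i j x) \<partial>expo 1) \<in> _\<close>] split[OF F]
  proof (rule nn_integral_cong)
    fix x assume x: "x \<in> space (Pi\<^sub>M S0 (bdry_law z))"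
    have space: "x \<in> space (Pi\<^sub>M S0 (\<lambda>_. borel :: real measure))"
      using x by (simp add: space_PiM)
    define f where "f h v = F (x(Inr j := v, Inl i := h))" for h v
    have "(\<lambda>p. x(Inr j := snd p, Inl i := fst p)) \<in> measurable (borel \<Otimes>\<^sub>M borel) (Pi\<^sub>M S (\<lambda>_. borel))"
      by (rule measurable_fun_upd[where J = "insert (Inr j) S0"], use S_eq in blast,
          rule measurable_fun_upd[where J = S0]) (use space in auto)
    then have f: "case_prod f \<in> borel_measurable (borel \<Otimes>\<^sub>M borel)"
      unfolding f_def by (simp add: case_prod_beta)
    have "flip a i j (x(Inr j := v, Inl i := h))
        = x(Inr j := a + max 0 (v - h), Inl i := a + max 0 (h - v))" for a h v
      by (auto simp: flip_def fun_eq_iff)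
    then show "(\<integral>\<^sup>+v. (\<integral>\<^sup>+h. (\<integral>\<^sup>+a. F (flip a i j (x(Inr j := v, Inl i := h))) \<partial>expo 1) \<partial>expo z) \<partial>expo (1 - z))
       = (\<integral>\<^sup>+v. (\<integral>\<^sup>+h. F (x(Inr j := v, Inl i := h)) \<partial>expo z) \<partial>expo (1 - z))"
      using burke[OF f, of z "1 - z"] z by (simp add: f_def)
  qed
qed

text \<open>
  Each cell is flipped once and with its own independent weight. Integrating out the weight of the
  first cell leaves the law of the increments unchanged, and the remaining flips see a fresh copy of
  the initial situation.
\<close>

proposition nn_integral_flips:
  assumes z: "0 < z" "z < 1" and S: "finite S" "\<And>i j. (i, j) \<in> set cs \<Longrightarrow> Inl i \<in> S \<and> Inr j \<in> S"
    and cs: "distinct cs"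
    and F [measurable]: "F \<in> borel_measurable (Pi\<^sub>M S (\<lambda>_. borel))"
  shows "(\<integral>\<^sup>+x. (\<integral>\<^sup>+w. F (flips w cs x) \<partial>Pi\<^sub>M (set cs) (\<lambda>_. expo 1)) \<partial>Pi\<^sub>M S (bdry_law z))
       = (\<integral>\<^sup>+x. F x \<partial>Pi\<^sub>M S (bdry_law z))"
  using S(2) cs
proof (induction cs)
  case Nil
  interpret product_prob_space "\<lambda>_::nat\<times>nat. expo 1" by (rule product_prob_space_expo) simp
  interpret prob_space "Pi\<^sub>M {} (\<lambda>_::nat\<times>nat. expo 1)" by (rule prob_space_PiM) (rule M.prob_space_axioms)
  show ?case by (simp add: flips_def emeasure_space_1)
next
  case (Cons c cs)
  interpret W: product_prob_space "\<lambda>_::nat\<times>nat. expo 1" by (rule product_prob_space_expo) simp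
  interpret PW: prob_space "Pi\<^sub>M (set cs) (\<lambda>_::nat\<times>nat. expo 1)" by (rule prob_space_PiM) (rule W.M.prob_space_axioms)
  define F' where "F' y = (\<integral>\<^sup>+w. F (flips w cs y) \<partial>Pi\<^sub>M (set cs) (\<lambda>_. expo 1))" for y
  have c: "Inl (fst c) \<in> S" "Inr (snd c) \<in> S" using Cons.prems(1)[of "fst c" "snd c"] by auto
  have [measurable]: "F' \<in> borel_measurable (Pi\<^sub>M S (\<lambda>_. borel))"
  proof -
    have "(\<lambda>p. flips (snd p) cs (fst p)) \<in>
        measurable (Pi\<^sub>M S (\<lambda>_. borel) \<Otimes>\<^sub>M Pi\<^sub>M (set cs) (\<lambda>_. expo 1)) (Pi\<^sub>M S (\<lambda>_. borel))"
      by (rule measurable_flips[where C = "set cs"]) (use Cons.prems in auto)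
    then have [measurable]: "(\<lambda>p. F (flips (snd p) cs (fst p))) \<in>
        borel_measurable (Pi\<^sub>M S (\<lambda>_. borel) \<Otimes>\<^sub>M Pi\<^sub>M (set cs) (\<lambda>_. expo 1))"
      by measurable
    show ?thesis
      unfolding F'_def by (rule PW.borel_measurable_nn_integral) (simp add: case_prod_beta)
  qed
  have fl: "flips (w(c := a)) (c # cs) x = flips w cs (flip a (fst c) (snd c) x)" for w a x
  proof -
    have "flips (w(c := a)) cs y = flips w cs y" for y
      unfolding flips_def by (rule fold_cong) (use Cons.prems(2) in auto)
    then show ?thesis by (simp add: flips_def)
  qed
  have "(\<integral>\<^sup>+x. (\<integral>\<^sup>+w. F (flips w (c # cs) x) \<partial>Pi\<^sub>M (set (c # cs)) (\<lambda>_. expo 1)) \<partial>Pi\<^sub>M S (bdry_law z))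
      = (\<integral>\<^sup>+x. (\<integral>\<^sup>+a. F' (flip a (fst c) (snd c) x) \<partial>expo 1) \<partial>Pi\<^sub>M S (bdry_law z))"
  proof (rule nn_integral_cong)
    fix x assume "x \<in> space (Pi\<^sub>M S (bdry_law z))"
    then have x: "x \<in> space (Pi\<^sub>M S (\<lambda>_. borel :: real measure))"
      by (simp add: space_PiM)
    have "(\<lambda>w. flips w (c # cs) x) \<in> measurable (Pi\<^sub>M (insert c (set cs)) (\<lambda>_. expo 1)) (Pi\<^sub>M S (\<lambda>_. borel))"
      by (rule measurable_flips[where C = "insert c (set cs)"]) (use x Cons.prems in auto)
    then have m: "(\<lambda>w. F (flips w (c # cs) x)) \<in> borel_measurable (Pi\<^sub>M (insert c (set cs)) (\<lambda>_. expo 1))"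
      by measurable
    show "(\<integral>\<^sup>+w. F (flips w (c # cs) x) \<partial>Pi\<^sub>M (set (c # cs)) (\<lambda>_. expo 1))
        = (\<integral>\<^sup>+a. F' (flip a (fst c) (snd c) x) \<partial>expo 1)"
      unfolding list.set(2)
      by (subst W.product_nn_integral_insert_rev[OF _ _ m]) (use Cons.prems in \<open>auto simp: fl F'_def\<close>)
  qed
  also have "\<dots> = (\<integral>\<^sup>+x. F' x \<partial>Pi\<^sub>M S (bdry_law z))"
    by (rule nn_integral_flip[OF z S(1) c]) measurable
  also have "\<dots> = (\<integral>\<^sup>+x. F x \<partial>Pi\<^sub>M S (bdry_law z))"
    unfolding F'_def by (rule Cons.IH) (use Cons.prems in auto)
  finally show ?case .
qed

section \<open>Running maximum of a product of independent factors\<close>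

text \<open>
  The recursion is \<open>max_k \<Prod>_{i<k} u (s + i) = max 1 (u s * max_k \<Prod>_{i<k} u (s + 1 + i))\<close>. It splits off
  the first factor, as the induction over independent factors requires.
\<close>

primrec running_max :: "(nat \<Rightarrow> real) \<Rightarrow> nat \<Rightarrow> nat \<Rightarrow> real" where
  "running_max u s 0 = 1"
| "running_max u s (Suc K) = max 1 (u s * running_max u (Suc s) K)"

lemma running_max_cong:
  "(\<And>k. s \<le> k \<Longrightarrow> k < s + K \<Longrightarrow> u k = u' k) \<Longrightarrow> running_max u s K = running_max u' s K"
proof (induction K arbitrary: s)
  case (Suc K)
  have "running_max u (Suc s) K = running_max u' (Suc s) K"
    by (rule Suc.IH) (use Suc.prems in auto)
  then show ?case using Suc.prems[of s] by simp
qed simp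

lemma running_max_nonneg: "0 \<le> running_max u s K"
  by (cases K) auto

lemma prod_le_running_max:
  assumes "\<And>k. 0 \<le> u k" "k \<le> K"
  shows "(\<Prod>i<k. u (s + i)) \<le> running_max u s K"
  using assms(2)
proof (induction k arbitrary: s K)
  case 0
  show ?case by (cases K) auto
next
  case (Suc k)
  then obtain K' where K: "K = Suc K'" "k \<le> K'" by (cases K) auto
  have "(\<Prod>i<Suc k. u (s + i)) = u s * (\<Prod>i<k. u (Suc s + i))"
    by (subst prod.lessThan_Suc_shift) simp
  also have "\<dots> \<le> u s * running_max u (Suc s) K'"
    by (rule mult_left_mono[OF Suc.IH[OF K(2)] assms(1)])
  finally show ?case by (simp add: K)
qed

lemma measurable_running_max:
  assumes "\<And>k. s \<le> k \<Longrightarrow> k < s + K \<Longrightarrow> (\<lambda>x. u x k) \<in> borel_measurable N"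
  shows "(\<lambda>x. running_max (u x) s K) \<in> borel_measurable N"
  using assms
proof (induction K arbitrary: s)
  case (Suc K)
  have [measurable]: "(\<lambda>x. running_max (u x) (Suc s) K) \<in> borel_measurable N"
    by (rule Suc.IH) (use Suc.prems in auto)
  have [measurable]: "(\<lambda>x. u x s) \<in> borel_measurable N" by (rule Suc.prems) auto
  show ?case by simp
qed simp

lemma max_plus_square_div_le:
  fixes x r :: real
  assumes "0 < x"
  shows "max x r + r\<^sup>2 / max x r \<le> x + r\<^sup>2 / x"
proof (cases "r \<le> x")
  case False
  have "0 \<le> (x - r)\<^sup>2 / x" using assms by simp
  also have "(x - r)\<^sup>2 / x = x + r\<^sup>2 / x - 2 * r"
    using assms by (simp add: field_simps power2_eq_square)
  finally show ?thesis using False assms by (simp add: max_def power2_eq_square)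
qed (simp add: max_def)

text \<open>
  A maximal inequality in the spirit of Doob for a product of independent factors \<open>g\<close> with second
  moment at most 1. Integrating over the first factor last, the induction hypothesis bounds the
  integral by \<open>m + (r g)^2 / m\<close> with \<open>m = max x r\<close>. This is linear in \<open>g^2\<close>, so that the moment assumption
  gives \<open>m + r^2 / m\<close>, which is at most \<open>x + r^2 / x\<close> by the arithmetic-geometric mean inequality.
  Each factor depends on two coordinates, a horizontal and a vertical step of the staircase.
\<close>

proposition (in product_prob_space) nn_integral_running_max:
  fixes g :: "'a \<Rightarrow> 'a \<Rightarrow> real" and c d :: "nat \<Rightarrow> 'i"
  assumes J: "finite J" "c ` {s..<s + K} \<union> d ` {s..<s + K} \<subseteq> J"
    and inj: "inj_on c {s..<s + K}" "inj_on d {s..<s + K}" "c ` {s..<s + K} \<inter> d ` {s..<s + K} = {}"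
    and g_nonneg: "\<And>a b. 0 \<le> g a b"
    and meas: "\<And>k. s \<le> k \<Longrightarrow> k < s + K \<Longrightarrow> case_prod g \<in> borel_measurable (M (c k) \<Otimes>\<^sub>M M (d k))"
    and sq: "\<And>k. s \<le> k \<Longrightarrow> k < s + K \<Longrightarrow> (\<integral>\<^sup>+b. (\<integral>\<^sup>+a. ennreal ((g a b)\<^sup>2) \<partial>M (c k)) \<partial>M (d k)) \<le> 1"
    and x: "0 < x" and r: "0 \<le> r"
  shows "(\<integral>\<^sup>+y. ennreal (max x (r * running_max (\<lambda>k. g (y (c k)) (y (d k))) s K)) \<partial>Pi\<^sub>M J M)
       \<le> ennreal (x + r\<^sup>2 / x)"
  using J inj meas sq x r
proof (induction K arbitrary: s J x r)
  case 0
  interpret PJ: prob_space "Pi\<^sub>M J M" by (rule prob_space_PiM) (rule M.prob_space_axioms)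
  have "0 \<le> r\<^sup>2 / max x r" using 0 by simp
  then have "max x r \<le> x + r\<^sup>2 / x"
    using max_plus_square_div_le[of x r] 0 by linarith
  then show ?case
    by (simp add: PJ.emeasure_space_1 ennreal_leI del: ennreal_plus)
next
  case (Suc K)
  define J' where "J' = J - {c s, d s}"
  have cd: "c s \<in> J" "d s \<in> J" "c s \<noteq> d s"
  proof -
    have *: "c s \<in> c ` {s..<s + Suc K}" "d s \<in> d ` {s..<s + Suc K}" by auto
    then show "c s \<in> J" "d s \<in> J" using Suc.prems(2) by blast+
    show "c s \<noteq> d s" using * Suc.prems(5) by (metis IntI emptyE)
  qed
  have J: "J = insert (c s) (insert (d s) J')" and J': "finite J'" "c s \<notin> insert (d s) J'" "d s \<notin> J'"
    using cd Suc.prems(1) by (auto simp: J'_def)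
  have ne: "c k \<noteq> c s" "d k \<noteq> d s" "c k \<noteq> d s" "d k \<noteq> c s" "c k \<in> J'" "d k \<in> J'"
    if "Suc s \<le> k" "k < Suc s + K" for k
  proof -
    show 1: "c k \<noteq> c s" "d k \<noteq> d s"
      using inj_onD[OF Suc.prems(3), of k s] inj_onD[OF Suc.prems(4), of k s] that by auto
    have "c k \<in> c ` {s..<s + Suc K}" "d k \<in> d ` {s..<s + Suc K}" "c s \<in> c ` {s..<s + Suc K}" "d s \<in> d ` {s..<s + Suc K}"
      using that by auto
    then show 2: "c k \<noteq> d s" "d k \<noteq> c s"
      using Suc.prems(5) by (metis IntI emptyE)+
    show "c k \<in> J'" "d k \<in> J'"
      using 1 2 that Suc.prems(2) by (auto simp: J'_def)
  qed
  define R :: "('i \<Rightarrow> 'a) \<Rightarrow> real" where "R y = running_max (\<lambda>k. g (y (c k)) (y (d k))) (Suc s) K" for y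
  have R_upd: "R (f(d s := b, c s := a)) = R f" for f a b
    unfolding R_def by (rule running_max_cong) (use ne in auto)
  have R_meas: "R \<in> borel_measurable (Pi\<^sub>M I M)" if "J' \<subseteq> I" for I
    unfolding R_def
  proof (rule measurable_running_max)
    fix k assume k: "Suc s \<le> k" "k < Suc s + K"
    have "case_prod g \<in> borel_measurable (M (c k) \<Otimes>\<^sub>M M (d k))"
      by (rule Suc.prems(6)) (use k in auto)
    moreover have "(\<lambda>y. (y (c k), y (d k))) \<in> measurable (Pi\<^sub>M I M) (M (c k) \<Otimes>\<^sub>M M (d k))"
      by (rule measurable_Pair; rule measurable_component_singleton) (use ne[OF k] that in auto)
    ultimately show "(\<lambda>y. g (y (c k)) (y (d k))) \<in> borel_measurable (Pi\<^sub>M I M)"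
      by (auto dest: measurable_compose)
  qed
  have gs [measurable]: "case_prod g \<in> borel_measurable (M (c s) \<Otimes>\<^sub>M M (d s))"
    by (rule Suc.prems(6)) auto
  have gs_J: "(\<lambda>y. g (y (c s)) (y (d s))) \<in> borel_measurable (Pi\<^sub>M J M)"
  proof -
    have "(\<lambda>y. (y (c s), y (d s))) \<in> measurable (Pi\<^sub>M J M) (M (c s) \<Otimes>\<^sub>M M (d s))"
      by (rule measurable_Pair; rule measurable_component_singleton) (use cd in auto)
    from measurable_compose[OF this gs] show ?thesis by simp
  qed
  define m where "m = max x r"
  have m: "0 < m" using Suc.prems by (simp add: m_def)
  define F where "F y = ennreal (max m (r * g (y (c s)) (y (d s)) * R y))" for y
  have F_meas [measurable]: "F \<in> borel_measurable (Pi\<^sub>M J M)"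
    using R_meas[of J] gs_J unfolding F_def by (auto simp: J'_def)
  have "ennreal (max x (r * running_max (\<lambda>k. g (y (c k)) (y (d k))) s (Suc K))) = F y" for y
    using Suc.prems(9) by (simp add: F_def R_def m_def max_mult_distrib_left mult.assoc)
  then have "(\<integral>\<^sup>+y. ennreal (max x (r * running_max (\<lambda>k. g (y (c k)) (y (d k))) s (Suc K))) \<partial>Pi\<^sub>M J M)
      = (\<integral>\<^sup>+y. F y \<partial>Pi\<^sub>M J M)" by simp
  also have "\<dots> = (\<integral>\<^sup>+a. (\<integral>\<^sup>+y. F (y(c s := a)) \<partial>Pi\<^sub>M (insert (d s) J') M) \<partial>M (c s))"
    unfolding J by (rule product_nn_integral_insert_rev) (use J' F_meas J in auto)
  also have "\<dots> = (\<integral>\<^sup>+a. (\<integral>\<^sup>+b. (\<integral>\<^sup>+y. F (y(d s := b, c s := a)) \<partial>Pi\<^sub>M J' M) \<partial>M (d s)) \<partial>M (c s))"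
  proof (rule nn_integral_cong)
    fix a assume a: "a \<in> space (M (c s))"
    have "(\<lambda>y. y(c s := a)) \<in> measurable (Pi\<^sub>M (insert (d s) J') M) (Pi\<^sub>M J M)"
      by (rule measurable_fun_upd[where J = "insert (d s) J'"]) (use J a in auto)
    from measurable_compose[OF this F_meas]
    show "(\<integral>\<^sup>+y. F (y(c s := a)) \<partial>Pi\<^sub>M (insert (d s) J') M)
        = (\<integral>\<^sup>+b. (\<integral>\<^sup>+y. F (y(d s := b, c s := a)) \<partial>Pi\<^sub>M J' M) \<partial>M (d s))"
      by (intro product_nn_integral_insert_rev J') simp
  qed
  also have "\<dots> \<le> (\<integral>\<^sup>+a. (\<integral>\<^sup>+b. ennreal (m + (r * g a b)\<^sup>2 / m) \<partial>M (d s)) \<partial>M (c s))"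
  proof (intro nn_integral_mono)
    fix a b
    have "(\<integral>\<^sup>+y. ennreal (max m ((r * g a b) * R y)) \<partial>Pi\<^sub>M J' M) \<le> ennreal (m + (r * g a b)\<^sup>2 / m)"
      unfolding R_def
    proof (rule Suc.IH)
      have sub: "{Suc s..<Suc s + K} \<subseteq> {s..<s + Suc K}" by auto
      show "inj_on c {Suc s..<Suc s + K}" "inj_on d {Suc s..<Suc s + K}"
        using inj_on_subset[OF Suc.prems(3) sub] inj_on_subset[OF Suc.prems(4) sub] by simp_all
      show "c ` {Suc s..<Suc s + K} \<inter> d ` {Suc s..<Suc s + K} = {}"
        using Suc.prems(5) image_mono[OF sub, of c] image_mono[OF sub, of d] by blast
      show "c ` {Suc s..<Suc s + K} \<union> d ` {Suc s..<Suc s + K} \<subseteq> J'"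
        using ne by auto
      show "case_prod g \<in> borel_measurable (M (c k) \<Otimes>\<^sub>M M (d k))" if "Suc s \<le> k" "k < Suc s + K" for k
        by (rule Suc.prems(6)) (use that in linarith)+
      show "(\<integral>\<^sup>+b. (\<integral>\<^sup>+a. ennreal ((g a b)\<^sup>2) \<partial>M (c k)) \<partial>M (d k)) \<le> 1"
        if "Suc s \<le> k" "k < Suc s + K" for k
        by (rule Suc.prems(7)) (use that in linarith)+
      show "0 \<le> r * g a b" by (rule mult_nonneg_nonneg[OF Suc.prems(9) g_nonneg])
    qed (rule J' m)+
    moreover have "F (y(d s := b, c s := a)) = ennreal (max m ((r * g a b) * R y))" for y
      using cd by (simp add: F_def R_upd)
    ultimately show "(\<integral>\<^sup>+y. F (y(d s := b, c s := a)) \<partial>Pi\<^sub>M J' M) \<le> ennreal (m + (r * g a b)\<^sup>2 / m)"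
      by simp
  qed
  also have "\<dots> = (\<integral>\<^sup>+a. (\<integral>\<^sup>+b. ennreal m + ennreal (r\<^sup>2 / m) * ennreal ((g a b)\<^sup>2) \<partial>M (d s)) \<partial>M (c s))"
    using m by (simp add: ennreal_plus[symmetric] ennreal_mult[symmetric] power_mult_distrib del: ennreal_plus)
  also have "\<dots> = ennreal m + ennreal (r\<^sup>2 / m) * (\<integral>\<^sup>+a. (\<integral>\<^sup>+b. ennreal ((g a b)\<^sup>2) \<partial>M (d s)) \<partial>M (c s))"
  proof -
    have "(\<integral>\<^sup>+b. ennreal m + ennreal (r\<^sup>2 / m) * ennreal ((g a b)\<^sup>2) \<partial>M (d s))
        = ennreal m + ennreal (r\<^sup>2 / m) * (\<integral>\<^sup>+b. ennreal ((g a b)\<^sup>2) \<partial>M (d s))"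
      if "a \<in> space (M (c s))" for a
    proof -
      have [measurable]: "(\<lambda>b. g a b) \<in> borel_measurable (M (d s))"
        using measurable_compose_Pair1[OF that gs] by simp
      show ?thesis by (simp add: nn_integral_add nn_integral_cmult M.emeasure_space_1)
    qed
    then have "(\<integral>\<^sup>+a. (\<integral>\<^sup>+b. ennreal m + ennreal (r\<^sup>2 / m) * ennreal ((g a b)\<^sup>2) \<partial>M (d s)) \<partial>M (c s))
        = (\<integral>\<^sup>+a. ennreal m + ennreal (r\<^sup>2 / m) * (\<integral>\<^sup>+b. ennreal ((g a b)\<^sup>2) \<partial>M (d s)) \<partial>M (c s))"
      by (rule nn_integral_cong)
    also have "\<dots> = ennreal m + ennreal (r\<^sup>2 / m) * (\<integral>\<^sup>+a. (\<integral>\<^sup>+b. ennreal ((g a b)\<^sup>2) \<partial>M (d s)) \<partial>M (c s))"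
      by (simp add: nn_integral_add nn_integral_cmult M.emeasure_space_1)
    finally show ?thesis .
  qed
  also have "(\<integral>\<^sup>+a. (\<integral>\<^sup>+b. ennreal ((g a b)\<^sup>2) \<partial>M (d s)) \<partial>M (c s))
      = (\<integral>\<^sup>+b. (\<integral>\<^sup>+a. ennreal ((g a b)\<^sup>2) \<partial>M (c s)) \<partial>M (d s))"
    by (rule pair_sigma_finite.Fubini'[symmetric]) (auto intro: pair_sigma_finite.intro sigma_finite_measures)
  also have "ennreal m + ennreal (r\<^sup>2 / m) * \<dots> \<le> ennreal m + ennreal (r\<^sup>2 / m) * 1"
    by (intro add_left_mono mult_left_mono Suc.prems(7)) auto
  also have "\<dots> = ennreal (m + r\<^sup>2 / m)"
    using m by simp
  also have "\<dots> \<le> ennreal (x + r\<^sup>2 / x)"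
    unfolding m_def by (intro ennreal_leI max_plus_square_div_le Suc.prems)
  finally show ?case .
qed

section \<open>Exponential moment of the maximal passage time\<close>

lemma borel_measurable_sum_list:
  fixes f :: "'b \<Rightarrow> 'a \<Rightarrow> real"
  assumes "\<And>v. v \<in> set vs \<Longrightarrow> f v \<in> borel_measurable N"
  shows "(\<lambda>w. \<Sum>v\<leftarrow>vs. f v w) \<in> borel_measurable N"
  using assms by (induction vs) auto

lemma measurable_last_passage_time:
  assumes "\<And>i j. i \<le> a \<Longrightarrow> j \<le> b \<Longrightarrow> (i, j) \<in> C"
  shows "(\<lambda>w. last_passage_time (\<lambda>v. w (nat (fst v), nat (snd v))) (0, 0) (int a, int b))
           \<in> borel_measurable (Pi\<^sub>M C (\<lambda>_. borel))"
proof -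
  have "(\<lambda>w. path_weight (\<lambda>v. w (nat (fst v), nat (snd v))) p) \<in> borel_measurable (Pi\<^sub>M C (\<lambda>_. borel))"
    if "p \<in> up_right_paths (0, 0) (int a, int b)" for p
  proof -
    have "(nat (fst v), nat (snd v)) \<in> C" if "v \<in> set (butlast p)" for v
    proof (rule assms)
      have "p \<noteq> []" "successively up_right_step p" "hd p = (0, 0)" "last p = (int a, int b)"
        using \<open>p \<in> _\<close> by (auto simp: up_right_paths_def)
      from up_right_path_props(1)[OF this(1,2) in_set_butlastD[OF that]] this(3,4)
      show "nat (fst v) \<le> a" "nat (snd v) \<le> b" by auto
    qed
    then show ?thesis
      unfolding path_weight_def by (intro borel_measurable_sum_list) simp
  qed
  then show ?thesis
    unfolding last_passage_time_def
    by (intro borel_measurable_Max finite_up_right_paths) auto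
qed

lemma cells_box:
  assumes "0 < n" "K < m" "l \<le> K" "i \<le> m - 1 - l" "j \<le> n - 1 + l"
  shows "(i, j) \<in> set (cells m n (n + K))"
  using assms by (auto simp: set_cells row_width_def)

text \<open>
  The end points are \<open>(m - 1 - l, n - 1 + l)\<close> for \<open>l \<le> K\<close>. The factor \<open>\<kappa>\<close> is chosen such that a staircase
  step \<open>\<kappa> * exp (\<eta> * (V - H))\<close> has second moment at most 1, since
  \<open>E exp (2 * \<eta> * (V - H)) = z * (1 - z) / ((z + 2 * \<eta>) * (1 - z - 2 * \<eta>))\<close>. The axis is divided out:
  multiplying the left hand side by \<open>E exp (- \<eta> \<Sum> H) = (z / (z + \<eta>))^m\<close> makes the
  integrand a lower bound for a function of the final increments alone, and these have the law \<open>bdry_law z\<close>.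
\<close>

proposition exp_moment_max_last_passage_time:
  fixes z \<eta> \<kappa> :: real and m n K :: nat
  assumes z: "0 < z" "0 < \<eta>" "z + 2 * \<eta> < 1" and mn: "0 < n" "K < m"
    and \<kappa>: "0 < \<kappa>" "\<kappa>\<^sup>2 * (z * (1 - z)) \<le> (z + 2 * \<eta>) * (1 - z - 2 * \<eta>)"
  defines "T \<equiv> \<lambda>w l. last_passage_time (\<lambda>v. w (nat (fst v), nat (snd v))) (0, 0) (int (m - 1 - l), int (n - 1 + l))"
  shows "(\<integral>\<^sup>+w. ennreal (Max ((\<lambda>l. \<kappa> ^ l * exp (\<eta> * T w l)) ` {..K})) \<partial>Pi\<^sub>M (set (cells m n (n + K))) (\<lambda>_. expo 1))
       \<le> ennreal (2 * ((z + \<eta>) / z) ^ m * ((1 - z) / (1 - z - \<eta>)) ^ n)"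
proof -
  define cs where "cs = cells m n (n + K)"
  define S where "S = Inl ` {..<m} \<union> Inr ` {..<n + K}"
  define Q where "Q w = Max ((\<lambda>l. \<kappa> ^ l * exp (\<eta> * T w l)) ` {..K})" for w
  define u where "u y k = \<kappa> * exp (\<eta> * (y (Inr (n + k)) - y (Inl (m - 1 - k))))" for y :: "nat + nat \<Rightarrow> real" and k
  define \<Psi> where "\<Psi> y = ennreal ((\<Prod>j<n. exp (\<eta> * y (Inr j))) * running_max (u y) 0 K)" for y
  define W where "W = Pi\<^sub>M (set cs) (\<lambda>_. expo 1)"
  interpret product_prob_space "bdry_law z" UNIV by (rule product_prob_space_bdry_law) (use z in auto)
  interpret W: product_prob_space "\<lambda>_. expo 1" "UNIV :: (nat \<times> nat) set" by (rule product_prob_space_expo) simp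
  interpret PW: prob_space W unfolding W_def by (rule prob_space_PiM) (rule W.M.prob_space_axioms)
  have W_sets [measurable_cong]: "sets W = sets (Pi\<^sub>M (set cs) (\<lambda>_. borel))"
    unfolding W_def by (rule sets_PiM_expo)
  have S: "finite S" "\<And>i j. (i, j) \<in> set cs \<Longrightarrow> Inl i \<in> S \<and> Inr j \<in> S"
    by (auto simp: S_def cs_def set_cells row_width_def)
  have [measurable]: "(\<lambda>w. T w l) \<in> borel_measurable W" if "l \<le> K" for l
    using measurable_last_passage_time[of "m - 1 - l" "n - 1 + l" "set cs"] cells_box[OF mn that]
    by (auto simp: T_def cs_def cong: measurable_cong_sets[OF W_sets refl])
  then have [measurable]: "Q \<in> borel_measurable W"
    unfolding Q_def by (intro borel_measurable_Max) auto
  have comp [measurable]: "(\<lambda>y. y e) \<in> borel_measurable (Pi\<^sub>M L (\<lambda>_. borel :: real measure))" if "e \<in> L" for e :: "nat + nat" and L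
    using that by simp
  have rm_meas: "(\<lambda>y. running_max (u y) 0 K) \<in> borel_measurable (Pi\<^sub>M L (\<lambda>_. borel))"
    if "Inl ` {..<m} \<subseteq> L" "Inr ` {n..<n + K} \<subseteq> L" for L
  proof (rule measurable_running_max)
    fix k assume "k < 0 + K"
    then have "Inr (n + k) \<in> L" "Inl (m - 1 - k) \<in> L"
      using that mn by (auto simp: image_subset_iff)
    then show "(\<lambda>y. u y k) \<in> borel_measurable (Pi\<^sub>M L (\<lambda>_. borel))"
      unfolding u_def by measurable
  qed
  have [measurable]: "\<Psi> \<in> borel_measurable (Pi\<^sub>M S (\<lambda>_. borel))"
  proof -
    have "(\<lambda>y. \<Prod>j<n. exp (\<eta> * y (Inr j))) \<in> borel_measurable (Pi\<^sub>M S (\<lambda>_. borel :: real measure))"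
      by (rule borel_measurable_prod) (auto simp: S_def)
    moreover have "(\<lambda>y. running_max (u y) 0 K) \<in> borel_measurable (Pi\<^sub>M S (\<lambda>_. borel))"
      by (rule rm_meas) (auto simp: S_def)
    ultimately show ?thesis
      unfolding \<Psi>_def by measurable
  qed

  have axis: "(\<integral>\<^sup>+x. ennreal (exp (- \<eta> * (\<Sum>i<m. x (Inl i)))) \<partial>Pi\<^sub>M S (bdry_law z)) = ennreal ((z / (z + \<eta>)) ^ m)"
  proof -
    define f :: "nat + nat \<Rightarrow> real \<Rightarrow> ennreal"
      where "f e a = (case e of Inl _ \<Rightarrow> ennreal (exp (- \<eta> * a)) | Inr _ \<Rightarrow> 1)" for e a
    have f_eq: "f (Inl i) = (\<lambda>a. ennreal (exp (- \<eta> * a)))" "f (Inr j) = (\<lambda>_. 1)" for i j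
      by (auto simp: f_def fun_eq_iff)
    have f: "f e \<in> borel_measurable (bdry_law z e)" for e
      by (cases e) (auto simp: f_eq)
    have "ennreal (exp (- \<eta> * (\<Sum>i<m. x (Inl i)))) = (\<Prod>e\<in>S. f e (x e))" for x
      unfolding S_def
      by (subst prod.union_disjoint)
        (auto simp: f_def prod.reindex exp_sum sum_distrib_left prod_ennreal simp flip: sum_negf)
    then have "(\<integral>\<^sup>+x. ennreal (exp (- \<eta> * (\<Sum>i<m. x (Inl i)))) \<partial>Pi\<^sub>M S (bdry_law z))
        = (\<Prod>e\<in>S. \<integral>\<^sup>+a. f e a \<partial>bdry_law z e)"
      using product_nn_integral_prod[of S f] f S(1) by simp
    also have "\<dots> = (\<Prod>i<m. \<integral>\<^sup>+a. ennreal (exp (- \<eta> * a)) \<partial>expo z) * (\<Prod>j<n+K. \<integral>\<^sup>+a. 1 \<partial>expo (1 - z))"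
      unfolding S_def by (subst prod.union_disjoint) (auto simp: f_eq prod.reindex)
    also have "(\<integral>\<^sup>+a. 1 \<partial>expo (1 - z)) = 1"
      using M.emeasure_space_1[of "Inr 0"] by simp
    also have "(\<integral>\<^sup>+a. ennreal (exp (- \<eta> * a)) \<partial>expo z) = ennreal (z / (z + \<eta>))"
      using expo_mgf[of z "- \<eta>"] z by simp
    finally show ?thesis using z by (simp add: ennreal_power)
  qed

  have pointwise: "ennreal (exp (- \<eta> * (\<Sum>i<m. x (Inl i)))) * ennreal (Q w) \<le> \<Psi> (flips w cs x)"
    if x0: "0 \<le> x (Inl 0)" and w: "\<And>l. l \<le> K \<Longrightarrow> 0 \<le> w (m - 1 - l, n - 1 + l)" for x w
  proof -
    let ?y = "flips w cs x"
    have x: "x = case_sum (x \<circ> Inl) (x \<circ> Inr)" by (auto simp: fun_eq_iff split: sum.splits)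
    have "exp (- \<eta> * (\<Sum>i<m. x (Inl i))) * (\<kappa> ^ l * exp (\<eta> * T w l))
        \<le> (\<Prod>j<n. exp (\<eta> * ?y (Inr j))) * running_max (u ?y) 0 K" if l: "l \<le> K" for l
    proof -
      have "T w l \<le> bdry_lpp (x \<circ> Inl) (x \<circ> Inr) w (Suc (m - 1 - l)) (Suc (n - 1 + l))"
        unfolding T_def by (rule last_passage_time_le_bdry_lpp) (use x0 w l in auto)
      also have "Suc (m - 1 - l) = m - l" using mn l by simp
      also have "Suc (n - 1 + l) = n + l" using mn by simp
      also have "bdry_lpp (x \<circ> Inl) (x \<circ> Inr) w (m - l) (n + l) =
          (\<Sum>i<m. x (Inl i)) + (\<Sum>j<n. ?y (Inr j)) + (\<Sum>k<l. ?y (Inr (n + k)) - ?y (Inl (m - 1 - k)))"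
        unfolding cs_def using bdry_lpp_staircase[OF x, of K m l w n] mn l by simp
      finally have "\<eta> * T w l \<le> \<eta> * ((\<Sum>i<m. x (Inl i)) + (\<Sum>j<n. ?y (Inr j)) + (\<Sum>k<l. ?y (Inr (n + k)) - ?y (Inl (m - 1 - k))))"
        using z by (intro mult_left_mono) auto
      then have "exp (- \<eta> * (\<Sum>i<m. x (Inl i))) * exp (\<eta> * T w l)
          \<le> exp (\<eta> * (\<Sum>j<n. ?y (Inr j)) + \<eta> * (\<Sum>k<l. ?y (Inr (n + k)) - ?y (Inl (m - 1 - k))))"
        by (simp add: algebra_simps flip: exp_add)
      also have "\<dots> = (\<Prod>j<n. exp (\<eta> * ?y (Inr j))) * (\<Prod>k<l. exp (\<eta> * (?y (Inr (n + k)) - ?y (Inl (m - 1 - k)))))"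
        by (simp add: exp_add exp_sum sum_distrib_left)
      finally have "\<kappa> ^ l * (exp (- \<eta> * (\<Sum>i<m. x (Inl i))) * exp (\<eta> * T w l))
          \<le> \<kappa> ^ l * ((\<Prod>j<n. exp (\<eta> * ?y (Inr j))) * (\<Prod>k<l. exp (\<eta> * (?y (Inr (n + k)) - ?y (Inl (m - 1 - k))))))"
        using \<kappa> by (intro mult_left_mono) auto
      also have "\<dots> = (\<Prod>j<n. exp (\<eta> * ?y (Inr j))) * (\<Prod>k<l. u ?y (0 + k))"
        by (simp add: u_def prod.distrib)
      also have "\<dots> \<le> (\<Prod>j<n. exp (\<eta> * ?y (Inr j))) * running_max (u ?y) 0 K"
        using \<kappa> l by (intro mult_left_mono prod_le_running_max) (auto simp: u_def intro!: prod_nonneg)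
      finally show ?thesis by (simp add: mult_ac)
    qed
    moreover have "Q w \<in> (\<lambda>l. \<kappa> ^ l * exp (\<eta> * T w l)) ` {..K}"
      unfolding Q_def by (intro Max_in) auto
    ultimately show ?thesis
      unfolding \<Psi>_def using \<kappa> by (auto simp flip: ennreal_mult intro!: ennreal_leI)
  qed

  \<comment> \<open>The right side of the rectangle and the staircase use disjoint sets of coordinates.\<close>
  have final: "(\<integral>\<^sup>+y. \<Psi> y \<partial>Pi\<^sub>M S (bdry_law z)) \<le> ennreal (2 * ((1 - z) / (1 - z - \<eta>)) ^ n)"
  proof -
    define A J where "A = (Inr ` {..<n} :: (nat + nat) set)" and "J = Inl ` {..<m} \<union> Inr ` {n..<n + K}"
    have "{..<n + K} = {..<n} \<union> {n..<n + K}" by auto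
    then have S_eq: "S = A \<union> J" by (simp add: S_def A_def J_def image_Un Un_ac)
    have AJ: "A \<inter> J = {}" "finite A" "finite J"
      by (auto simp: A_def J_def)
    define P where "P y = ennreal (\<Prod>j<n. exp (\<eta> * y (Inr j)))" for y :: "nat + nat \<Rightarrow> real"
    define R where "R y = ennreal (running_max (u y) 0 K)" for y
    have P_prod: "P y = (\<Prod>e\<in>A. ennreal (exp (\<eta> * y e)))" for y
      by (simp add: P_def A_def prod.reindex prod_ennreal)
    have [measurable]: "R \<in> borel_measurable (Pi\<^sub>M J (bdry_law z))"
      using rm_meas[of J] unfolding R_def by (auto simp: J_def)
    have [measurable]: "P \<in> borel_measurable (Pi\<^sub>M A (bdry_law z))"
      unfolding P_prod by (intro borel_measurable_prod_ennreal) (auto simp: A_def)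
    have "\<Psi> (merge A J (x, y)) = P x * R y" for x y
    proof -
      have "running_max (u (merge A J (x, y))) 0 K = running_max (u y) 0 K"
      proof (rule running_max_cong)
        fix k assume "k < 0 + K"
        then have "Inr (n + k) \<in> J" "Inl (m - 1 - k) \<in> J" "Inr (n + k) \<notin> A" "Inl (m - 1 - k) \<notin> A"
          using mn by (auto simp: J_def A_def)
        then show "u (merge A J (x, y)) k = u y k" by (simp add: u_def merge_def)
      qed
      moreover have "merge A J (x, y) (Inr j) = x (Inr j)" if "j < n" for j
        using that by (simp add: merge_def A_def)
      ultimately show ?thesis
        by (simp add: \<Psi>_def P_def R_def ennreal_mult prod_nonneg running_max_nonneg)
    qed
    moreover have "\<Psi> \<in> borel_measurable (Pi\<^sub>M (A \<union> J) (bdry_law z))"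
      unfolding S_eq[symmetric] by measurable
    ultimately have "(\<integral>\<^sup>+y. \<Psi> y \<partial>Pi\<^sub>M S (bdry_law z))
       = (\<integral>\<^sup>+x. (\<integral>\<^sup>+y. P x * R y \<partial>Pi\<^sub>M J (bdry_law z)) \<partial>Pi\<^sub>M A (bdry_law z))"
      using product_nn_integral_fold[of A J \<Psi>] AJ by (simp add: S_eq)
    also have "\<dots> = (\<integral>\<^sup>+x. P x \<partial>Pi\<^sub>M A (bdry_law z)) * (\<integral>\<^sup>+y. R y \<partial>Pi\<^sub>M J (bdry_law z))"
      by (simp add: nn_integral_cmult nn_integral_multc)
    also have "(\<integral>\<^sup>+x. P x \<partial>Pi\<^sub>M A (bdry_law z)) = ennreal (((1 - z) / (1 - z - \<eta>)) ^ n)"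
    proof -
      have "(\<integral>\<^sup>+x. P x \<partial>Pi\<^sub>M A (bdry_law z)) = (\<Prod>e\<in>A. \<integral>\<^sup>+a. ennreal (exp (\<eta> * a)) \<partial>bdry_law z e)"
        unfolding P_prod
      proof (rule product_nn_integral_prod)
        show "(\<lambda>a. ennreal (exp (\<eta> * a))) \<in> borel_measurable (bdry_law z e)" for e
          by (subst measurable_cong_sets[OF sets_bdry_law refl]) simp
      qed (rule AJ)
      also have "\<dots> = (\<Prod>j<n. ennreal ((1 - z) / (1 - z - \<eta>)))"
        unfolding A_def using z by (simp add: prod.reindex expo_mgf)
      finally show ?thesis using z by (simp add: ennreal_power)
    qed
    also have "(\<integral>\<^sup>+y. R y \<partial>Pi\<^sub>M J (bdry_law z)) \<le> ennreal 2"
    proof -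
      define g where "g a b = \<kappa> * exp (\<eta> * (b - a))" for a b :: real
      have sq: "(\<integral>\<^sup>+b. (\<integral>\<^sup>+a. ennreal ((g a b)\<^sup>2) \<partial>expo z) \<partial>expo (1 - z)) \<le> 1"
      proof -
        have "ennreal ((g a b)\<^sup>2) = ennreal (\<kappa>\<^sup>2) * ennreal (exp ((2 * \<eta>) * b)) * ennreal (exp (- (2 * \<eta>) * a))" for a b
          unfolding g_def power_mult_distrib exp_double[symmetric]
          by (simp add: algebra_simps flip: ennreal_mult exp_add)
        then have "(\<integral>\<^sup>+b. (\<integral>\<^sup>+a. ennreal ((g a b)\<^sup>2) \<partial>expo z) \<partial>expo (1 - z))
            = ennreal (\<kappa>\<^sup>2) * (\<integral>\<^sup>+b. ennreal (exp ((2 * \<eta>) * b)) \<partial>expo (1 - z)) * (\<integral>\<^sup>+a. ennreal (exp (- (2 * \<eta>) * a)) \<partial>expo z)"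
          by (simp add: nn_integral_cmult nn_integral_multc)
        also have "\<dots> = ennreal (\<kappa>\<^sup>2 * ((1 - z) / (1 - z - 2 * \<eta>)) * (z / (z + 2 * \<eta>)))"
        proof -
          have A: "0 \<le> (1 - z) / (1 - z - 2 * \<eta>)" and B: "0 \<le> z / (z + 2 * \<eta>)"
            using z by auto
          have "(\<integral>\<^sup>+b. ennreal (exp ((2 * \<eta>) * b)) \<partial>expo (1 - z)) = ennreal ((1 - z) / (1 - z - 2 * \<eta>))"
            using z by (intro expo_mgf) auto
          moreover have "(\<integral>\<^sup>+a. ennreal (exp (- (2 * \<eta>) * a)) \<partial>expo z) = ennreal (z / (z + 2 * \<eta>))"
            using expo_mgf[of z "- (2 * \<eta>)"] z by simp
          ultimately show ?thesis
            by (simp only: ennreal_mult[OF mult_nonneg_nonneg[OF zero_le_power2 A] B] ennreal_mult[OF zero_le_power2 A])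
        qed
        also have "\<kappa>\<^sup>2 * ((1 - z) / (1 - z - 2 * \<eta>)) * (z / (z + 2 * \<eta>)) = \<kappa>\<^sup>2 * (z * (1 - z)) / ((z + 2 * \<eta>) * (1 - z - 2 * \<eta>))"
          by (simp add: mult_ac)
        also have "\<dots> \<le> 1"
          using \<kappa> z by (subst divide_le_eq_1_pos) auto
        finally show ?thesis by (simp add: ennreal_leI)
      qed
      have "(\<integral>\<^sup>+y. R y \<partial>Pi\<^sub>M J (bdry_law z))
          \<le> (\<integral>\<^sup>+y. ennreal (max 1 (1 * running_max (\<lambda>k. g (y (Inl (m - 1 - k))) (y (Inr (n + k)))) 0 K)) \<partial>Pi\<^sub>M J (bdry_law z))"
        unfolding R_def u_def g_def by (intro nn_integral_mono ennreal_leI) auto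
      also have "\<dots> \<le> ennreal (1 + 1\<^sup>2 / 1)"
        by (rule nn_integral_running_max)
          (use sq mn \<kappa> in \<open>auto simp: AJ J_def g_def inj_on_def\<close>)
      finally show ?thesis by simp
    qed
    also have "ennreal (((1 - z) / (1 - z - \<eta>)) ^ n) * ennreal 2 = ennreal (2 * ((1 - z) / (1 - z - \<eta>)) ^ n)"
      using z by (simp add: ennreal_mult mult.commute)
    finally show ?thesis by (simp add: mult_left_mono)
  qed

  have "ennreal ((z / (z + \<eta>)) ^ m) * (\<integral>\<^sup>+w. ennreal (Q w) \<partial>W)
      = (\<integral>\<^sup>+x. (\<integral>\<^sup>+w. ennreal (exp (- \<eta> * (\<Sum>i<m. x (Inl i)))) * ennreal (Q w) \<partial>W) \<partial>Pi\<^sub>M S (bdry_law z))"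
  proof -
    have "(\<lambda>x. ennreal (exp (- \<eta> * (\<Sum>i<m. x (Inl i))))) \<in> borel_measurable (Pi\<^sub>M S (bdry_law z))"
    proof -
      have "(\<lambda>x. \<Sum>i<m. x (Inl i)) \<in> borel_measurable (Pi\<^sub>M S (\<lambda>_. borel :: real measure))"
        by (rule borel_measurable_sum) (auto simp: S_def)
      then show ?thesis by measurable
    qed
    then show ?thesis
      by (simp add: nn_integral_cmult nn_integral_multc axis[symmetric])
  qed
  also have "\<dots> \<le> (\<integral>\<^sup>+x. (\<integral>\<^sup>+w. \<Psi> (flips w cs x) \<partial>W) \<partial>Pi\<^sub>M S (bdry_law z))"
  proof (rule nn_integral_mono_AE)
    have "AE x in Pi\<^sub>M S (bdry_law z). 0 \<le> x (Inl 0)"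
    proof (rule AE_PiM_component)
      show "AE a in bdry_law z (Inl 0). 0 \<le> a" unfolding bdry_law_simps by (rule AE_expo_nonneg)
      show "Inl 0 \<in> S" using mn by (simp add: S_def)
    qed (rule M.prob_space_axioms)
    then show "AE x in Pi\<^sub>M S (bdry_law z).
        (\<integral>\<^sup>+w. ennreal (exp (- \<eta> * (\<Sum>i<m. x (Inl i)))) * ennreal (Q w) \<partial>W) \<le> (\<integral>\<^sup>+w. \<Psi> (flips w cs x) \<partial>W)"
    proof eventually_elim
      case (elim x)
      have "AE w in W. \<forall>l\<in>{..K}. 0 \<le> w (m - 1 - l, n - 1 + l)"
        unfolding W_def cs_def
      proof (intro AE_finite_allI finite_atMost)
        fix l assume "l \<in> {..K}"
        then show "AE w in Pi\<^sub>M (set (cells m n (n + K))) (\<lambda>_. expo 1). 0 \<le> w (m - 1 - l, n - 1 + l)"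
          by (intro AE_PiM_component W.M.prob_space_axioms AE_expo_nonneg cells_box[OF mn, of l]) auto
      qed
      then have "AE w in W. ennreal (exp (- \<eta> * (\<Sum>i<m. x (Inl i)))) * ennreal (Q w) \<le> \<Psi> (flips w cs x)"
        by eventually_elim (use pointwise elim in auto)
      then show ?case by (rule nn_integral_mono_AE)
    qed
  qed
  also have "\<dots> = (\<integral>\<^sup>+y. \<Psi> y \<partial>Pi\<^sub>M S (bdry_law z))"
    unfolding W_def
    by (rule nn_integral_flips) (use z S in \<open>auto simp: cs_def distinct_cells\<close>)
  also note final
  finally have "ennreal (((z + \<eta>) / z) ^ m) * (ennreal ((z / (z + \<eta>)) ^ m) * (\<integral>\<^sup>+w. ennreal (Q w) \<partial>W))
     \<le> ennreal (((z + \<eta>) / z) ^ m) * ennreal (2 * ((1 - z) / (1 - z - \<eta>)) ^ n)"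
    by (rule mult_left_mono) simp
  moreover have "ennreal (((z + \<eta>) / z) ^ m) * ennreal ((z / (z + \<eta>)) ^ m) = 1"
    using z by (simp flip: ennreal_mult power_mult_distrib)
  ultimately have "(\<integral>\<^sup>+w. ennreal (Q w) \<partial>W) \<le> ennreal (((z + \<eta>) / z) ^ m) * ennreal (2 * ((1 - z) / (1 - z - \<eta>)) ^ n)"
    by (simp add: mult.assoc[symmetric])
  also have "\<dots> = ennreal (2 * ((z + \<eta>) / z) ^ m * ((1 - z) / (1 - z - \<eta>)) ^ n)"
    using z by (simp add: mult_ac flip: ennreal_mult)
  finally show ?thesis
    unfolding Q_def W_def cs_def .
qed

section \<open>Tail bound for a block of end points\<close>

lemma nn_integral_iid_weights:
  fixes X :: "int \<times> int \<Rightarrow> 'a \<Rightarrow> real" and C :: "(nat \<times> nat) set"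
  assumes "prob_space M" "iid_exp1_weights M X" "C \<noteq> {}"
    and F [measurable]: "F \<in> borel_measurable (Pi\<^sub>M C (\<lambda>_. borel))"
  shows "(\<integral>\<^sup>+\<omega>. F (\<lambda>c\<in>C. X (int (fst c), int (snd c)) \<omega>) \<partial>M) = (\<integral>\<^sup>+w. F w \<partial>Pi\<^sub>M C (\<lambda>_. expo 1))"
proof -
  interpret prob_space M by fact
  define e where "e = (\<lambda>c::nat \<times> nat. (int (fst c), int (snd c)))"
  have inj: "inj_on e C" by (auto simp: e_def inj_on_def prod_eq_iff)
  have indep: "indep_vars (\<lambda>_. borel) X (e ` C)"
    using assms(2) by (auto simp: iid_exp1_weights_def intro: indep_vars_subset)
  have dX: "distributed M lborel (X v) (exponential_density 1)" for v
    using assms(2) unfolding iid_exp1_weights_def by blast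
  then have X [measurable]: "X v \<in> borel_measurable M" for v
    using distributed_measurable[OF dX] by simp
  have law: "distr M borel (X v) = expo 1" for v
    using distributed_distr_eq_density[OF dX, of v] by (simp cong: distr_cong)
  have joint: "distr M (Pi\<^sub>M (e ` C) (\<lambda>_. borel)) (\<lambda>\<omega>. \<lambda>v\<in>e ` C. X v \<omega>) = Pi\<^sub>M (e ` C) (\<lambda>_. expo 1)"
    using indep indep_vars_iff_distr_eq_PiM'[of "e ` C" X "\<lambda>_. borel"] assms(3) by (simp add: law)
  have reindex: "distr (Pi\<^sub>M (e ` C) (\<lambda>_. expo 1)) (Pi\<^sub>M C (\<lambda>_. expo 1)) (\<lambda>w. \<lambda>c\<in>C. w (e c)) = Pi\<^sub>M C (\<lambda>_. expo 1)"
    by (rule distr_PiM_reindex) (auto intro: prob_space_exponential_density inj)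
  have r [measurable]: "(\<lambda>w. \<lambda>c\<in>C. w (e c)) \<in> measurable (Pi\<^sub>M (e ` C) (\<lambda>_. borel)) (Pi\<^sub>M C (\<lambda>_. borel :: real measure))"
    by (rule measurable_restrict) (rule measurable_component_singleton, simp)
  have "(\<integral>\<^sup>+w. F w \<partial>Pi\<^sub>M C (\<lambda>_. expo 1)) = (\<integral>\<^sup>+w. F (\<lambda>c\<in>C. w (e c)) \<partial>Pi\<^sub>M (e ` C) (\<lambda>_. expo 1))"
    by (subst reindex[symmetric], rule nn_integral_distr) measurable
  also have "\<dots> = (\<integral>\<^sup>+\<omega>. F (\<lambda>c\<in>C. (\<lambda>v\<in>e ` C. X v \<omega>) (e c)) \<partial>M)"
    by (subst joint[symmetric], rule nn_integral_distr) measurable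
  also have "\<dots> = (\<integral>\<^sup>+\<omega>. F (\<lambda>c\<in>C. X (e c) \<omega>) \<partial>M)"
    by (intro nn_integral_cong arg_cong[of _ _ F]) (auto simp: restrict_def fun_eq_iff)
  finally show ?thesis by (simp add: e_def)
qed

text \<open>
  Markov's inequality for the exponential moment. The weights enter only through the finitely many
  cells below the block, whose joint law is a product of exponential laws.
\<close>

proposition prob_max_last_passage_time_le:
  fixes X :: "int \<times> int \<Rightarrow> 'a \<Rightarrow> real" and x z \<eta> \<kappa> :: real and m n K :: nat
  assumes M: "prob_space M" "iid_exp1_weights M X"
    and z: "0 < z" "0 < \<eta>" "z + 2 * \<eta> < 1" and mn: "0 < n" "K < m"
    and \<kappa>: "0 < \<kappa>" "\<kappa>\<^sup>2 * (z * (1 - z)) \<le> (z + 2 * \<eta>) * (1 - z - 2 * \<eta>)"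
  defines "E \<equiv> {\<omega>\<in>space M. \<exists>l\<le>K. exp x \<le> \<kappa> ^ l * exp (\<eta> *
                  last_passage_time (\<lambda>v. X v \<omega>) (0, 0) (int (m - 1 - l), int (n - 1 + l)))}"
  shows "E \<in> sets M"
    and "measure M E \<le> exp (- x) * (2 * ((z + \<eta>) / z) ^ m * ((1 - z) / (1 - z - \<eta>)) ^ n)"
proof -
  interpret prob_space M by fact
  define C where "C = set (cells m n (n + K))"
  define T where "T w l = last_passage_time (\<lambda>v. w (nat (fst v), nat (snd v))) (0, 0) (int (m - 1 - l), int (n - 1 + l))"
    for w :: "nat \<times> nat \<Rightarrow> real" and l
  define Q where "Q w = Max ((\<lambda>l. \<kappa> ^ l * exp (\<eta> * T w l)) ` {..K})" for w
  define Y where "Y \<omega> = (\<lambda>c\<in>C. X (int (fst c), int (snd c)) \<omega>)" for \<omega>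
  have X [measurable]: "X v \<in> borel_measurable M" for v
    using M(2) distributed_measurable[of M lborel "X v"] unfolding iid_exp1_weights_def by fastforce
  have Y [measurable]: "Y \<in> measurable M (Pi\<^sub>M C (\<lambda>_. borel))"
    unfolding Y_def by (rule measurable_restrict) measurable
  have [measurable]: "(\<lambda>w. T w l) \<in> borel_measurable (Pi\<^sub>M C (\<lambda>_. borel))" if "l \<le> K" for l
    unfolding T_def C_def by (rule measurable_last_passage_time) (rule cells_box[OF mn that])
  then have [measurable]: "Q \<in> borel_measurable (Pi\<^sub>M C (\<lambda>_. borel))"
    unfolding Q_def by (intro borel_measurable_Max) auto
  have T: "last_passage_time (\<lambda>v. X v \<omega>) (0, 0) (int (m - 1 - l), int (n - 1 + l)) = T (Y \<omega>) l"
    if "l \<le> K" for l \<omega>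
    unfolding T_def
  proof (rule last_passage_time_cong)
    fix i j :: int
    assume ij: "0 \<le> i" "i \<le> fst (int (m - 1 - l), int (n - 1 + l))" "0 \<le> j" "j \<le> snd (int (m - 1 - l), int (n - 1 + l))"
    then have "(nat i, nat j) \<in> C"
      unfolding C_def by (intro cells_box[OF mn that]) auto
    then show "X (i, j) \<omega> = Y \<omega> (nat (fst (i, j)), nat (snd (i, j)))"
      using ij by (simp add: Y_def)
  qed
  have E: "E = {\<omega>\<in>space M. 1 \<le> ennreal (exp (- x)) * ennreal (Q (Y \<omega>))}"
  proof -
    have "(\<exists>l\<le>K. exp x \<le> \<kappa> ^ l * exp (\<eta> * last_passage_time (\<lambda>v. X v \<omega>) (0, 0) (int (m - 1 - l), int (n - 1 + l))))
        \<longleftrightarrow> 1 \<le> ennreal (exp (- x)) * ennreal (Q (Y \<omega>))" for \<omega>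
    proof -
      have "(\<exists>l\<le>K. exp x \<le> \<kappa> ^ l * exp (\<eta> * last_passage_time (\<lambda>v. X v \<omega>) (0, 0) (int (m - 1 - l), int (n - 1 + l))))
        \<longleftrightarrow> (\<exists>l\<le>K. exp x \<le> \<kappa> ^ l * exp (\<eta> * T (Y \<omega>) l))"
        by (simp only: T cong: conj_cong)
      also have "\<dots> \<longleftrightarrow> exp x \<le> Q (Y \<omega>)"
        unfolding Q_def by (subst Max_ge_iff) auto
      also have "\<dots> \<longleftrightarrow> 1 \<le> exp (- x) * Q (Y \<omega>)"
        by (simp add: exp_minus field_simps)
      also have "\<dots> \<longleftrightarrow> 1 \<le> ennreal (exp (- x)) * ennreal (Q (Y \<omega>))"
        by (subst ennreal_mult'[symmetric]) simp_all
      finally show ?thesis .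
    qed
    then show ?thesis unfolding E_def by simp
  qed
  show "E \<in> sets M" unfolding E by measurable
  have "C \<noteq> {}"
    using cells_box[OF mn, of 0 0 0] by (auto simp: C_def)
  have "emeasure M E \<le> ennreal (exp (- x)) * (\<integral>\<^sup>+\<omega>. ennreal (Q (Y \<omega>)) * indicator (space M) \<omega> \<partial>M)"
    unfolding E by (rule nn_integral_Markov_inequality) measurable
  also have "(\<integral>\<^sup>+\<omega>. ennreal (Q (Y \<omega>)) * indicator (space M) \<omega> \<partial>M) = (\<integral>\<^sup>+\<omega>. ennreal (Q (Y \<omega>)) \<partial>M)"
    by (intro nn_integral_cong) simp
  also have "\<dots> = (\<integral>\<^sup>+w. ennreal (Q w) \<partial>Pi\<^sub>M C (\<lambda>_. expo 1))"
    unfolding Y_def by (rule nn_integral_iid_weights[OF M \<open>C \<noteq> {}\<close>]) measurable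
  also have "\<dots> \<le> ennreal (2 * ((z + \<eta>) / z) ^ m * ((1 - z) / (1 - z - \<eta>)) ^ n)"
    unfolding Q_def T_def C_def by (rule exp_moment_max_last_passage_time[OF z mn \<kappa>])
  finally have "emeasure M E \<le> ennreal (exp (- x)) * ennreal (2 * ((z + \<eta>) / z) ^ m * ((1 - z) / (1 - z - \<eta>)) ^ n)"
    by (simp add: mult_left_mono)
  then have "emeasure M E \<le> ennreal (exp (- x) * (2 * ((z + \<eta>) / z) ^ m * ((1 - z) / (1 - z - \<eta>)) ^ n))"
    by (simp add: ennreal_mult')
  moreover have "0 \<le> exp (- x) * (2 * ((z + \<eta>) / z) ^ m * ((1 - z) / (1 - z - \<eta>)) ^ n)"
    using z by simp
  ultimately show "measure M E \<le> exp (- x) * (2 * ((z + \<eta>) / z) ^ m * ((1 - z) / (1 - z - \<eta>)) ^ n)"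
    by (simp add: emeasure_eq_measure)
qed

section \<open>Choice of the parameters\<close>

lemma ln_ratio_lower:
  fixes u :: real
  assumes "0 \<le> u" "u < 1"
  shows "2 * u + 2/3 * u ^ 3 \<le> ln (1 + u) - ln (1 - u)"
proof -
  let ?f = "\<lambda>x::real. ln (1 + x) - ln (1 - x) - 2 * x - 2/3 * x ^ 3"
  have "?f 0 \<le> ?f u"
  proof (rule DERIV_nonneg_imp_nondecreasing[OF assms(1)])
    fix x :: real assume x: "0 \<le> x" "x \<le> u"
    have "(?f has_real_derivative (1 / (1 + x) + 1 / (1 - x) - 2 - 2 * x\<^sup>2)) (at x)"
      using x assms by (auto intro!: derivative_eq_intros simp: power2_eq_square)
    moreover have "1 / (1 + x) + 1 / (1 - x) - 2 - 2 * x\<^sup>2 = 2 * x ^ 4 / ((1 + x) * (1 - x))"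
      using x assms by (simp add: divide_simps) algebra
    moreover have "0 \<le> 2 * x ^ 4 / ((1 + x) * (1 - x))"
      using x assms by simp
    ultimately show "\<exists>y. (?f has_real_derivative y) (at x) \<and> 0 \<le> y"
      by (intro exI conjI) (assumption, simp only:)
  qed
  then show ?thesis by simp
qed

lemma ln_ratio_upper_nonneg:
  fixes u :: real
  assumes "0 \<le> u" "u \<le> 1/2"
  shows "ln (1 + u) - ln (1 - u) \<le> 2 * u + 2/3 * u ^ 3 + 2 * u ^ 5"
proof -
  let ?f = "\<lambda>x::real. 2 * x + 2/3 * x ^ 3 + 2 * x ^ 5 - (ln (1 + x) - ln (1 - x))"
  have "?f 0 \<le> ?f u"
  proof (rule DERIV_nonneg_imp_nondecreasing[OF assms(1)])
    fix x :: real assume x: "0 \<le> x" "x \<le> u"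
    have "(?f has_real_derivative (2 + 2 * x\<^sup>2 + 10 * x ^ 4 - (1 / (1 + x) + 1 / (1 - x)))) (at x)"
      using x assms by (auto intro!: derivative_eq_intros simp: power2_eq_square)
    moreover have "2 + 2 * x\<^sup>2 + 10 * x ^ 4 - (1 / (1 + x) + 1 / (1 - x)) = 2 * x ^ 4 * (4 - 5 * x\<^sup>2) / ((1 + x) * (1 - x))"
      using x assms by (simp add: divide_simps) algebra
    moreover have "0 \<le> 2 * x ^ 4 * (4 - 5 * x\<^sup>2) / ((1 + x) * (1 - x))"
    proof -
      have "x\<^sup>2 \<le> 1" using x assms power_le_one[of x 2] by simp
      moreover have "x\<^sup>2 \<le> (1/2)\<^sup>2" using x assms by (intro power_mono) auto
      ultimately show ?thesis using x assms by (intro divide_nonneg_pos mult_nonneg_nonneg) (auto simp: power2_eq_square)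
    qed
    ultimately show "\<exists>y. (?f has_real_derivative y) (at x) \<and> 0 \<le> y"
      by (intro exI conjI) (assumption, simp only:)
  qed
  then show ?thesis by simp
qed

lemma ln_ratio_upper:
  fixes u :: real
  assumes "\<bar>u\<bar> \<le> 1/2"
  shows "ln (1 + u) - ln (1 - u) \<le> 2 * u + 2/3 * u ^ 3 + 2 * \<bar>u\<bar> ^ 5"
proof (cases "0 \<le> u")
  case True
  then show ?thesis using ln_ratio_upper_nonneg[of u] assms by simp
next
  case False
  then have "2 * (- u) + 2/3 * (- u) ^ 3 \<le> ln (1 - u) - ln (1 + u)"
    using ln_ratio_lower[of "- u"] assms by simp
  moreover have "0 \<le> \<bar>u\<bar> ^ 5" "(- u) ^ 3 = - (u ^ 3)" by simp_all
  ultimately show ?thesis by linarith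
qed

lemma ln_one_minus_square_bounds:
  fixes u :: real
  assumes "\<bar>u\<bar> \<le> 1/2"
  shows "- u\<^sup>2 - 2 * u ^ 4 \<le> ln (1 + u) + ln (1 - u)" and "ln (1 + u) + ln (1 - u) \<le> - u\<^sup>2"
proof -
  have "u\<^sup>2 \<le> (1/2)\<^sup>2" using assms by (metis abs_le_square_iff abs_of_pos half_gt_zero zero_less_one)
  then have u2: "u\<^sup>2 \<le> 1/2" by (simp add: power2_eq_square)
  have ln: "ln (1 + u) + ln (1 - u) = ln (1 - u\<^sup>2)"
    using assms by (subst ln_mult_pos[symmetric]) (auto simp: power2_eq_square algebra_simps)
  have "- u\<^sup>2 - 2 * (u\<^sup>2)\<^sup>2 \<le> ln (1 - u\<^sup>2)"
    by (rule ln_one_minus_pos_lower_bound) (use u2 in auto)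
  then show "- u\<^sup>2 - 2 * u ^ 4 \<le> ln (1 + u) + ln (1 - u)"
    unfolding ln by (simp flip: power_mult)
  show "ln (1 + u) + ln (1 - u) \<le> - u\<^sup>2"
    unfolding ln using ln_le_minus_one[of "1 - u\<^sup>2"] u2 by simp
qed

text \<open>
  Here \<open>q = N powr (1/3)\<close>, \<open>a = 2 (z + \<eta>) - 1\<close>, \<open>b = 1 - 2 z\<close>, and the block starts \<open>k\<close> steps off the diagonal.
  The centre \<open>c\<close> of the interval \<open>{- b..a}\<close> is the characteristic direction of the block: it minimises
  \<open>4 * N * \<eta> * c^2 + 4 * k * \<eta> * c\<close>, and the minimum \<open>- \<eta> * k^2 / N\<close> combines with the parabola in the
  threshold, so that no term in \<open>k\<close> of order one remains. What survives as \<open>N\<close> grows is the cubic term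
  \<open>4/3 * h^3\<close>, the threshold \<open>h * Y\<close>, and the cost \<open>8 * h^2 + 4 * h\<close> of taking the maximum over a block
  of length at most \<open>2 * q^2\<close>. All other terms are \<open>O (1 / q)\<close>, with constants that are uniform in \<open>k\<close>; the
  last assumption on \<open>q\<close> makes their sum at most 1.
\<close>

lemma block_exponent:
  fixes q h C Y k K :: real
  defines "\<eta> \<equiv> h / q" and "c \<equiv> - k / (2 * q ^ 3)" and "D \<equiv> h + C / 2"
  defines "a \<equiv> \<eta> + c" and "b \<equiv> \<eta> - c" and "d \<equiv> 4 * \<eta> - (\<eta> - c)"
  assumes h: "0 < h" and k: "0 \<le> k" "k \<le> C * q\<^sup>2" and K: "0 \<le> K" "K \<le> 2 * q\<^sup>2"
    and q: "1 \<le> q" "10 * D \<le> q"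
      "2 * h * C + 1250 * D ^ 4 + 4 * h + 4/3 * h ^ 3 + h * C\<^sup>2 + 8 * D ^ 5 + 2 * C * D ^ 4 \<le> q"
  shows "\<bar>a\<bar> \<le> 1/2" "\<bar>b\<bar> \<le> 1/2" "\<bar>d\<bar> \<le> 1/2"
    and "- (\<eta> * (4 * q ^ 3 + Y * q) - \<eta> * k\<^sup>2 / q ^ 3 - 2 * \<eta> * k / q ^ 3 - \<eta> * K\<^sup>2 / q ^ 3 - 4 * K * \<eta>\<^sup>2 - K * d ^ 4)
        + (q ^ 3 + 1) * ((2 * a + 2/3 * a ^ 3 + 2 * \<bar>a\<bar> ^ 5) + (2 * b + 2/3 * b ^ 3 + 2 * \<bar>b\<bar> ^ 5))
        + k * (a\<^sup>2 + 2 * a ^ 4 - b\<^sup>2)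
      \<le> 4/3 * h ^ 3 - h * Y + 8 * h\<^sup>2 + 4 * h + 1"
proof -
  define p where "p = 1 / q"
  have p: "0 < p" "p \<le> 1" "p * q = 1" using q by (auto simp: p_def)
  have pq: "p\<^sup>2 * q\<^sup>2 = 1" "p ^ 3 * q ^ 3 = 1" "p ^ 4 * q\<^sup>2 = p\<^sup>2" "p ^ 5 * q ^ 3 = p\<^sup>2" "p ^ 3 * q\<^sup>2 = p"
    using q by (auto simp: p_def field_simps power2_eq_square numeral_eq_Suc)
  have C: "0 \<le> C" using k q by (smt (verit) mult_neg_pos zero_less_power)
  have \<eta>: "\<eta> = h * p" by (simp add: \<eta>_def p_def)
  have k_eq: "k = - 2 * q ^ 3 * c" using q by (simp add: c_def)
  have c: "c \<le> 0" "- c \<le> C / 2 * p"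
  proof -
    show "c \<le> 0" using k q by (simp add: c_def)
    have "- c = k * p ^ 3 / 2" by (simp add: c_def p_def power_divide)
    also have "\<dots> \<le> (C * q\<^sup>2) * p ^ 3 / 2" using k p by (intro divide_right_mono mult_right_mono) auto
    also have "\<dots> = C / 2 * (p ^ 3 * q\<^sup>2)" by simp
    finally show "- c \<le> C / 2 * p" unfolding pq .
  qed
  have D: "0 < D" using h C by (simp add: D_def)
  have \<eta>0: "0 < \<eta>" "\<eta> = h * p" using h p by (auto simp: \<eta>)
  have Dp: "D * p = \<eta> + C / 2 * p" by (simp add: D_def \<eta> algebra_simps)
  have ab: "\<bar>a\<bar> \<le> D * p" "\<bar>b\<bar> \<le> D * p" "\<bar>d\<bar> \<le> 5 * (D * p)"
    using c \<eta>0(1) unfolding Dp a_def b_def d_def abs_le_iff by (auto simp: field_simps)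
  have "10 * (D * p) \<le> 1"
    using mult_right_mono[OF q(2), of p] p by (simp add: mult_ac)
  then show small: "\<bar>a\<bar> \<le> 1/2" "\<bar>b\<bar> \<le> 1/2" "\<bar>d\<bar> \<le> 1/2"
    using ab by linarith+

  have pp: "p\<^sup>2 \<le> p" "p ^ 3 \<le> p"
    using p by (simp_all add: power2_eq_square power3_eq_cube mult_le_one mult_left_le)
  \<comment> \<open>The lower order terms, each at most a constant times \<open>p = 1 / q\<close>.\<close>
  have t1: "- 4 * \<eta> * c \<le> 2 * h * C * p"
  proof -
    have "- 4 * \<eta> * c = 4 * \<eta> * (- c)" by simp
    also have "\<dots> \<le> 4 * \<eta> * (C / 2 * p)" using c \<eta>0 by (intro mult_left_mono) auto
    also have "\<dots> = 2 * h * C * p\<^sup>2" by (simp add: \<eta> power2_eq_square)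
    also have "\<dots> \<le> 2 * h * C * p" using h C pp by (intro mult_left_mono) auto
    finally show ?thesis .
  qed
  have t2: "K * d ^ 4 \<le> 1250 * D ^ 4 * p"
  proof -
    have "d ^ 4 = \<bar>d\<bar> ^ 4" by simp
    also have "\<dots> \<le> (5 * (D * p)) ^ 4" using ab by (intro power_mono) auto
    finally have "K * d ^ 4 \<le> (2 * q\<^sup>2) * (5 * (D * p)) ^ 4" using K by (intro mult_mono) auto
    also have "\<dots> = 1250 * D ^ 4 * (p ^ 4 * q\<^sup>2)" by (simp add: power_mult_distrib)
    also have "\<dots> \<le> 1250 * D ^ 4 * p" unfolding pq using pp D by (intro mult_left_mono) auto
    finally show ?thesis .
  qed
  have t3: "4/3 * \<eta> ^ 3 \<le> 4/3 * h ^ 3 * p"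
    using pp h by (simp add: \<eta> power_mult_distrib)
  have t4: "4 * \<eta> * c\<^sup>2 \<le> h * C\<^sup>2 * p"
  proof -
    have "c\<^sup>2 = (- c)\<^sup>2" by simp
    also have "\<dots> \<le> (C / 2 * p)\<^sup>2" using c by (intro power_mono) auto
    finally have "4 * \<eta> * c\<^sup>2 \<le> 4 * \<eta> * (C / 2 * p)\<^sup>2" using \<eta>0 by (intro mult_left_mono) auto
    also have "\<dots> = h * C\<^sup>2 * p ^ 3" by (simp add: \<eta> power2_eq_square power3_eq_cube)
    also have "\<dots> \<le> h * C\<^sup>2 * p" using pp h by (intro mult_left_mono) auto
    finally show ?thesis .
  qed
  have t5: "(q ^ 3 + 1) * (2 * \<bar>a\<bar> ^ 5 + 2 * \<bar>b\<bar> ^ 5) \<le> 8 * D ^ 5 * p"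
  proof -
    have "\<bar>a\<bar> ^ 5 \<le> (D * p) ^ 5" "\<bar>b\<bar> ^ 5 \<le> (D * p) ^ 5" using ab by (auto intro: power_mono)
    moreover have "1 \<le> q ^ 3" using q by simp
    ultimately have "(q ^ 3 + 1) * (2 * \<bar>a\<bar> ^ 5 + 2 * \<bar>b\<bar> ^ 5) \<le> (2 * q ^ 3) * (4 * (D * p) ^ 5)"
      using q by (intro mult_mono) auto
    also have "\<dots> = 8 * D ^ 5 * (p ^ 5 * q ^ 3)" by (simp add: power_mult_distrib)
    also have "\<dots> \<le> 8 * D ^ 5 * p" unfolding pq using pp D by (intro mult_left_mono) auto
    finally show ?thesis .
  qed
  have t6: "k * (2 * a ^ 4) \<le> 2 * C * D ^ 4 * p"
  proof -
    have "a ^ 4 = \<bar>a\<bar> ^ 4" by simp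
    also have "\<dots> \<le> (D * p) ^ 4" using ab by (intro power_mono) auto
    finally have "k * (2 * a ^ 4) \<le> (C * q\<^sup>2) * (2 * (D * p) ^ 4)" using k by (intro mult_mono) auto
    also have "\<dots> = 2 * C * D ^ 4 * (p ^ 4 * q\<^sup>2)" by (simp add: power_mult_distrib)
    also have "\<dots> \<le> 2 * C * D ^ 4 * p" unfolding pq using pp D C by (intro mult_left_mono) auto
    finally show ?thesis .
  qed
  have t7: "\<eta> * K\<^sup>2 / q ^ 3 \<le> 4 * h"
  proof -
    have "K\<^sup>2 \<le> (2 * q\<^sup>2)\<^sup>2" using K by (intro power_mono) auto
    then have "\<eta> * K\<^sup>2 / q ^ 3 \<le> \<eta> * (2 * q\<^sup>2)\<^sup>2 / q ^ 3"
      using \<eta>0 q by (intro divide_right_mono mult_left_mono) auto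
    also have "\<dots> = 4 * h" using q by (simp add: \<eta>_def field_simps power2_eq_square power3_eq_cube)
    finally show ?thesis .
  qed
  have t8: "4 * K * \<eta>\<^sup>2 \<le> 8 * h\<^sup>2"
  proof -
    have "4 * K * \<eta>\<^sup>2 \<le> 4 * (2 * q\<^sup>2) * \<eta>\<^sup>2" using K by (intro mult_right_mono) auto
    also have "\<dots> = 8 * h\<^sup>2 * (p\<^sup>2 * q\<^sup>2)" by (simp add: \<eta> power_mult_distrib)
    finally show ?thesis unfolding pq by simp
  qed
  have t9: "4 * \<eta> = 4 * h * p" by (simp add: \<eta>)
  have "(2 * h * C + 1250 * D ^ 4 + 4 * h + 4/3 * h ^ 3 + h * C\<^sup>2 + 8 * D ^ 5 + 2 * C * D ^ 4) * p \<le> q * p"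
    using q(3) p by (intro mult_right_mono) auto
  then have sum: "2 * h * C * p + 1250 * D ^ 4 * p + 4 * h * p + 4/3 * h ^ 3 * p + h * C\<^sup>2 * p + 8 * D ^ 5 * p + 2 * C * D ^ 4 * p \<le> 1"
    using p by (simp add: algebra_simps)
  have e1: "\<eta> * k\<^sup>2 / q ^ 3 = 4 * q ^ 3 * \<eta> * c\<^sup>2" "2 * \<eta> * k / q ^ 3 = - 4 * \<eta> * c"
    using q unfolding k_eq by (simp_all add: field_simps power2_eq_square)
  have e2: "\<eta> * (Y * q) = h * Y" "q ^ 3 * \<eta> ^ 3 = h ^ 3"
    using q by (simp_all add: \<eta>_def power_divide)
  have main: "- (\<eta> * (4 * q ^ 3 + Y * q) - 4 * q ^ 3 * \<eta> * c\<^sup>2 - (- 4 * \<eta> * c) - \<eta> * K\<^sup>2 / q ^ 3 - 4 * K * \<eta>\<^sup>2 - K * d ^ 4)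
        + (q ^ 3 + 1) * ((2 * a + 2/3 * a ^ 3 + 2 * \<bar>a\<bar> ^ 5) + (2 * b + 2/3 * b ^ 3 + 2 * \<bar>b\<bar> ^ 5))
        + k * (a\<^sup>2 + 2 * a ^ 4 - b\<^sup>2)
     = - (\<eta> * (Y * q)) + 4/3 * (q ^ 3 * \<eta> ^ 3) + \<eta> * K\<^sup>2 / q ^ 3 + 4 * K * \<eta>\<^sup>2
        + (- 4 * \<eta> * c + K * d ^ 4 + 4 * \<eta> + 4/3 * \<eta> ^ 3 + 4 * \<eta> * c\<^sup>2
           + (q ^ 3 + 1) * (2 * \<bar>a\<bar> ^ 5 + 2 * \<bar>b\<bar> ^ 5) + k * (2 * a ^ 4))"
  proof -
    have s1: "2 * a + 2/3 * a ^ 3 + (2 * b + 2/3 * b ^ 3) = 4 * \<eta> + 4/3 * \<eta> ^ 3 + 4 * \<eta> * c\<^sup>2"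
      unfolding a_def b_def by algebra
    have s2: "a\<^sup>2 - b\<^sup>2 = 4 * \<eta> * c" unfolding a_def b_def by algebra
    have x1: "(q ^ 3 + 1) * ((2 * a + 2/3 * a ^ 3 + 2 * \<bar>a\<bar> ^ 5) + (2 * b + 2/3 * b ^ 3 + 2 * \<bar>b\<bar> ^ 5))
       = (q ^ 3 + 1) * (4 * \<eta> + 4/3 * \<eta> ^ 3 + 4 * \<eta> * c\<^sup>2) + (q ^ 3 + 1) * (2 * \<bar>a\<bar> ^ 5 + 2 * \<bar>b\<bar> ^ 5)"
      unfolding s1[symmetric] by (simp add: algebra_simps)
    have "k * (a\<^sup>2 + 2 * a ^ 4 - b\<^sup>2) = k * (a\<^sup>2 - b\<^sup>2) + k * (2 * a ^ 4)"
      by (simp add: algebra_simps)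
    also have "k * (a\<^sup>2 - b\<^sup>2) = - 8 * q ^ 3 * \<eta> * c\<^sup>2"
      unfolding s2 k_eq by (simp add: power2_eq_square)
    finally have x2: "k * (a\<^sup>2 + 2 * a ^ 4 - b\<^sup>2) = - 8 * q ^ 3 * \<eta> * c\<^sup>2 + k * (2 * a ^ 4)" .
    have x3: "(q ^ 3 + 1) * (4 * \<eta> + 4/3 * \<eta> ^ 3 + 4 * \<eta> * c\<^sup>2)
       = 4 * q ^ 3 * \<eta> + 4/3 * (q ^ 3 * \<eta> ^ 3) + 4 * q ^ 3 * \<eta> * c\<^sup>2 + 4 * \<eta> + 4/3 * \<eta> ^ 3 + 4 * \<eta> * c\<^sup>2"
      by (simp add: algebra_simps)
    have x4: "\<eta> * (4 * q ^ 3 + Y * q) = 4 * q ^ 3 * \<eta> + \<eta> * (Y * q)"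
      by (simp add: algebra_simps)
    show ?thesis
      unfolding x1 x2 x3 x4 by linarith
  qed
  show "- (\<eta> * (4 * q ^ 3 + Y * q) - \<eta> * k\<^sup>2 / q ^ 3 - 2 * \<eta> * k / q ^ 3 - \<eta> * K\<^sup>2 / q ^ 3 - 4 * K * \<eta>\<^sup>2 - K * d ^ 4)
        + (q ^ 3 + 1) * ((2 * a + 2/3 * a ^ 3 + 2 * \<bar>a\<bar> ^ 5) + (2 * b + 2/3 * b ^ 3 + 2 * \<bar>b\<bar> ^ 5))
        + k * (a\<^sup>2 + 2 * a ^ 4 - b\<^sup>2)
      \<le> 4/3 * h ^ 3 - h * Y + 8 * h\<^sup>2 + 4 * h + 1"
    unfolding e1 main e2 using t1 t2 t3 t4 t5 t6 t7 t8 t9 sum by linarith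
qed

section \<open>Union bound over the blocks\<close>

text \<open>
  The block bound in the scaling of the theorem. The term \<open>(k + l + 1)^2 / N\<close> is the parabola at the
  right end of the interval of parameters \<open>s\<close> with end point at offset \<open>k + l\<close>. The event is covered by
  a measurable set \<open>A\<close>, which is all that the union bound needs.
\<close>

lemma prob_block_le:
  fixes X :: "int \<times> int \<Rightarrow> 'a \<Rightarrow> real" and h C Y q :: real and N k K :: nat
  assumes M: "prob_space M" "iid_exp1_weights M X"
    and N: "real N = q ^ 3" and h: "0 < h"
    and k: "real k \<le> C * q\<^sup>2" and K: "1 \<le> K" "real K \<le> 2 * q\<^sup>2"
    and q: "1 \<le> q" "10 * (h + C / 2) \<le> q" "C + 2 \<le> q"
      "2 * h * C + 1250 * (h + C / 2) ^ 4 + 4 * h + 4/3 * h ^ 3 + h * C\<^sup>2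
         + 8 * (h + C / 2) ^ 5 + 2 * C * (h + C / 2) ^ 4 \<le> q"
  shows "\<exists>A\<in>sets M. {\<omega>\<in>space M. \<exists>l<K. 4 * real N + Y * q \<le>
            last_passage_time (\<lambda>v. X v \<omega>) (0, 0) (int N - int (k + l), int N + int (k + l))
              + (real (k + l) + 1)\<^sup>2 / real N} \<subseteq> A
          \<and> measure M A \<le> 2 * exp (4/3 * h ^ 3 - h * Y + 8 * h\<^sup>2 + 4 * h + 1)"
proof -
  define \<eta> c where "\<eta> = h / q" and "c = - real k / (2 * q ^ 3)"
  define a b d where "a = \<eta> + c" and "b = \<eta> - c" and "d = 4 * \<eta> - (\<eta> - c)"
  have d_eq: "d = 4 * \<eta> - b" by (simp add: d_def b_def)
  have "0 \<le> real k" "0 \<le> real K" by simp_all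
  note block = block_exponent[OF h this(1) k this(2) K(2) q(1,2,4), folded \<eta>_def c_def, folded a_def b_def d_def]
  define z where "z = (1 - b) / 2"
  \<comment> \<open>Then \<open>\<kappa>\<^sup>2 = exp (b\<^sup>2 - d\<^sup>2 - 2 * d ^ 4)\<close>, a lower bound for \<open>(1 - d\<^sup>2) / (1 - b\<^sup>2)\<close>.\<close>
  define \<kappa> where "\<kappa> = exp (- (8 * \<eta>\<^sup>2 - 4 * \<eta> * b + d ^ 4))"
  define m n where "m = N - k + 1" and "n = N + k + 1"
  define x where "x = \<eta> * (4 * q ^ 3 + Y * q) - \<eta> * (real k)\<^sup>2 / q ^ 3 - 2 * \<eta> * real k / q ^ 3
      - \<eta> * (real K)\<^sup>2 / q ^ 3 - 4 * real K * \<eta>\<^sup>2 - real K * d ^ 4"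
  have \<eta>: "0 < \<eta>" using h q by (simp add: \<eta>_def)
  have "real (k + K) \<le> (C + 2) * q\<^sup>2" using k K by (simp add: algebra_simps)
  also have "\<dots> \<le> q * q\<^sup>2" using q by (intro mult_right_mono) auto
  also have "\<dots> = real N" by (simp add: N power2_eq_square power3_eq_cube)
  finally have kN: "k + K \<le> N" by linarith
  have m: "K < m" "0 < n" "real m = q ^ 3 + 1 - real k" "real n = q ^ 3 + 1 + real k"
    using kN N by (auto simp: m_def n_def)
  have bd: "\<bar>a\<bar> \<le> 1/2" "\<bar>b\<bar> \<le> 1/2" "\<bar>d\<bar> \<le> 1/2" using block(1-3) by auto
  have z: "0 < z" "z + 2 * \<eta> < 1"
  proof -
    show "0 < z" using bd(2) unfolding z_def abs_le_iff by simp
    show "z + 2 * \<eta> < 1" using bd(3) unfolding z_def d_eq abs_le_iff by (simp add: field_simps)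
  qed
  have \<kappa>: "0 < \<kappa>" "\<kappa>\<^sup>2 * (z * (1 - z)) \<le> (z + 2 * \<eta>) * (1 - z - 2 * \<eta>)"
  proof -
    show "0 < \<kappa>" by (simp add: \<kappa>_def)
    have d2: "d\<^sup>2 = 16 * \<eta>\<^sup>2 - 8 * \<eta> * b + b\<^sup>2" unfolding d_eq by algebra
    have "\<kappa>\<^sup>2 = exp (- 2 * (8 * \<eta>\<^sup>2 - 4 * \<eta> * b + d ^ 4))"
      unfolding \<kappa>_def by (simp flip: exp_double)
    also have "- 2 * (8 * \<eta>\<^sup>2 - 4 * \<eta> * b + d ^ 4) = b\<^sup>2 + (- d\<^sup>2 - 2 * d ^ 4)"
      unfolding d2 by simp
    finally have "\<kappa>\<^sup>2 * (1 - b\<^sup>2) = exp (- d\<^sup>2 - 2 * d ^ 4) * (exp (b\<^sup>2) * (1 - b\<^sup>2))"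
      by (simp add: exp_add)
    also have "\<dots> \<le> exp (- d\<^sup>2 - 2 * d ^ 4) * 1"
    proof (rule mult_left_mono)
      have "1 - b\<^sup>2 \<le> exp (- b\<^sup>2)" using exp_ge_add_one_self[of "- b\<^sup>2"] by simp
      then have "exp (b\<^sup>2) * (1 - b\<^sup>2) \<le> exp (b\<^sup>2) * exp (- b\<^sup>2)" by (rule mult_left_mono) simp
      then show "exp (b\<^sup>2) * (1 - b\<^sup>2) \<le> 1" by (simp flip: exp_add)
    qed simp
    also have "\<dots> \<le> exp (ln (1 + d) + ln (1 - d))"
      using ln_one_minus_square_bounds(1)[OF bd(3)] by simp
    also have "\<dots> = (1 + d) * (1 - d)"
      using bd by (simp add: exp_add)
    finally have le: "\<kappa>\<^sup>2 * (1 - b\<^sup>2) / 4 \<le> (1 + d) * (1 - d) / 4" by simp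
    have z1: "z * (1 - z) = (1 - b\<^sup>2) / 4" by (simp add: z_def field_simps power2_eq_square)
    have z2: "(z + 2 * \<eta>) * (1 - z - 2 * \<eta>) = (1 + d) * (1 - d) / 4"
      by (simp add: z_def d_eq field_simps)
    show "\<kappa>\<^sup>2 * (z * (1 - z)) \<le> (z + 2 * \<eta>) * (1 - z - 2 * \<eta>)"
      unfolding z1 z2 using le by simp
  qed
  define A where "A = {\<omega>\<in>space M. \<exists>l\<le>K. exp x \<le> \<kappa> ^ l * exp (\<eta> *
                  last_passage_time (\<lambda>v. X v \<omega>) (0, 0) (int (m - 1 - l), int (n - 1 + l)))}"
  note prob = prob_max_last_passage_time_le[OF M z(1) \<eta> z(2) m(2,1) \<kappa>, of x, folded A_def]

  have bound: "exp (- x) * (2 * ((z + \<eta>) / z) ^ m * ((1 - z) / (1 - z - \<eta>)) ^ n)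
      \<le> 2 * exp (4/3 * h ^ 3 - h * Y + 8 * h\<^sup>2 + 4 * h + 1)"
  proof -
    have p: "0 < 1 + a" "0 < 1 - a" "0 < 1 + b" "0 < 1 - b" using bd by (auto simp: abs_le_iff)
    have \<eta>_eq: "2 * \<eta> = a + b" by (simp add: a_def b_def)
    have r1: "(z + \<eta>) / z = (1 + a) / (1 - b)"
    proof -
      have "z + \<eta> = (1 + a) / 2" using \<eta>_eq by (simp add: z_def field_simps)
      then show ?thesis by (simp add: z_def)
    qed
    have r2: "(1 - z) / (1 - z - \<eta>) = (1 + b) / (1 - a)"
    proof -
      have "1 - z = (1 + b) / 2" "1 - z - \<eta> = (1 - a) / 2" using \<eta>_eq by (simp_all add: z_def field_simps)
      then have "(1 - z) / (1 - z - \<eta>) = ((1 + b) / 2) / ((1 - a) / 2)" by (rule arg_cong2)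
      also have "\<dots> = (1 + b) / (1 - a)" using p by (simp add: divide_simps) (simp add: algebra_simps)
      finally show ?thesis .
    qed
    have "((z + \<eta>) / z) ^ m = exp (ln (1 + a) - ln (1 - b)) ^ m"
      unfolding r1 using p by (simp add: exp_diff)
    also have "\<dots> = exp (real m * (ln (1 + a) - ln (1 - b)))"
      by (rule exp_of_nat_mult[symmetric])
    finally have e1: "((z + \<eta>) / z) ^ m = exp (real m * (ln (1 + a) - ln (1 - b)))" .
    have "((1 - z) / (1 - z - \<eta>)) ^ n = exp (ln (1 + b) - ln (1 - a)) ^ n"
      unfolding r2 using p by (simp add: exp_diff)
    also have "\<dots> = exp (real n * (ln (1 + b) - ln (1 - a)))"
      by (rule exp_of_nat_mult[symmetric])
    finally have e2: "((1 - z) / (1 - z - \<eta>)) ^ n = exp (real n * (ln (1 + b) - ln (1 - a)))" .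
    have "real m * (ln (1 + a) - ln (1 - b)) + real n * (ln (1 + b) - ln (1 - a))
        = (q ^ 3 + 1) * ((ln (1 + a) - ln (1 - a)) + (ln (1 + b) - ln (1 - b)))
          + real k * (- (ln (1 + a) + ln (1 - a)) + (ln (1 + b) + ln (1 - b)))"
      unfolding m(3,4) by (simp add: algebra_simps)
    also have "\<dots> \<le> (q ^ 3 + 1) * ((2 * a + 2/3 * a ^ 3 + 2 * \<bar>a\<bar> ^ 5) + (2 * b + 2/3 * b ^ 3 + 2 * \<bar>b\<bar> ^ 5))
          + real k * ((a\<^sup>2 + 2 * a ^ 4) + - b\<^sup>2)"
    proof (intro add_mono mult_left_mono)
      show "- (ln (1 + a) + ln (1 - a)) \<le> a\<^sup>2 + 2 * a ^ 4"
        using ln_one_minus_square_bounds(1)[OF bd(1)] by simp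
      show "ln (1 + b) + ln (1 - b) \<le> - b\<^sup>2"
        by (rule ln_one_minus_square_bounds(2)[OF bd(2)])
    qed (use ln_ratio_upper[OF bd(1)] ln_ratio_upper[OF bd(2)] q in auto)
    finally have "- x + (real m * (ln (1 + a) - ln (1 - b)) + real n * (ln (1 + b) - ln (1 - a)))
        \<le> 4/3 * h ^ 3 - h * Y + 8 * h\<^sup>2 + 4 * h + 1"
      using block(4)[of Y] unfolding x_def by simp
    moreover have "exp (- x) * (2 * ((z + \<eta>) / z) ^ m * ((1 - z) / (1 - z - \<eta>)) ^ n)
        = 2 * exp (- x + (real m * (ln (1 + a) - ln (1 - b)) + real n * (ln (1 + b) - ln (1 - a))))"
      unfolding e1 e2 by (simp only: exp_add mult_ac)
    ultimately show ?thesis by simp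
  qed

  have sub: "{\<omega>\<in>space M. \<exists>l<K. 4 * real N + Y * q \<le>
            last_passage_time (\<lambda>v. X v \<omega>) (0, 0) (int N - int (k + l), int N + int (k + l))
              + (real (k + l) + 1)\<^sup>2 / real N} \<subseteq> A"
  proof safe
    fix \<omega> l assume \<omega>: "\<omega> \<in> space M" and l: "l < K"
      and T: "4 * real N + Y * q \<le>
            last_passage_time (\<lambda>v. X v \<omega>) (0, 0) (int N - int (k + l), int N + int (k + l))
              + (real (k + l) + 1)\<^sup>2 / real N"
    define T where "T = last_passage_time (\<lambda>v. X v \<omega>) (0, 0) (int N - int (k + l), int N + int (k + l))"
    have end_eq: "(int (m - 1 - l), int (n - 1 + l)) = (int N - int (k + l), int N + int (k + l))"
      using kN l by (simp add: m_def n_def)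
    have N0: "0 < q ^ 3" using q by simp
    have lK: "real l + 1 \<le> real K" using l by linarith
    have T': "4 * q ^ 3 + Y * q - (real k + real l + 1)\<^sup>2 / q ^ 3 \<le> T"
      using T by (simp add: T_def N)
    have c_eq: "c = - real k / q ^ 3 / 2" by (simp add: c_def)
    define r where "r = real k / q ^ 3"
    have r: "c = - r / 2" "r * real k = (real k)\<^sup>2 / q ^ 3" by (simp_all add: r_def c_eq power2_eq_square)
    have sq: "(real k + real l + 1)\<^sup>2 / q ^ 3 = (real k)\<^sup>2 / q ^ 3 + 2 * r * (real l + 1) + (real l + 1)\<^sup>2 / q ^ 3"
      by (simp add: r_def algebra_simps add_divide_distrib power2_eq_square)
    have l1: "real l * d ^ 4 \<le> real K * d ^ 4" using lK by (intro mult_right_mono) auto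
    have l2: "\<eta> * (real l + 1)\<^sup>2 / q ^ 3 \<le> \<eta> * (real K)\<^sup>2 / q ^ 3"
      using lK \<eta> N0 by (intro divide_right_mono mult_left_mono power_mono) auto
    have l3: "4 * real l * \<eta>\<^sup>2 \<le> 4 * real K * \<eta>\<^sup>2" using lK by (intro mult_right_mono) auto
    have "x = \<eta> * (4 * q ^ 3 + Y * q) - \<eta> * ((real k)\<^sup>2 / q ^ 3) - 2 * \<eta> * r
      - \<eta> * (real K)\<^sup>2 / q ^ 3 - 4 * real K * \<eta>\<^sup>2 - real K * d ^ 4"
      by (simp add: x_def r_def)
    also have "\<dots> \<le> \<eta> * (4 * q ^ 3 + Y * q) - \<eta> * ((real k)\<^sup>2 / q ^ 3) - 2 * \<eta> * r
      - \<eta> * (real l + 1)\<^sup>2 / q ^ 3 - 4 * real l * \<eta>\<^sup>2 - real l * d ^ 4"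
      using l1 l2 l3 by linarith
    also have "\<dots> = - real l * (8 * \<eta>\<^sup>2 - 4 * \<eta> * b + d ^ 4)
        + \<eta> * (4 * q ^ 3 + Y * q - (real k + real l + 1)\<^sup>2 / q ^ 3)"
      unfolding sq b_def r(1) by (simp add: algebra_simps power2_eq_square)
    also have "\<dots> \<le> - real l * (8 * \<eta>\<^sup>2 - 4 * \<eta> * b + d ^ 4) + \<eta> * T"
      using T' \<eta> by (intro add_left_mono mult_left_mono) auto
    finally have "x \<le> real l * - (8 * \<eta>\<^sup>2 - 4 * \<eta> * b + d ^ 4) + \<eta> * T"
      by (simp only: mult_minus_left mult_minus_right)
    then have "exp x \<le> exp (real l * - (8 * \<eta>\<^sup>2 - 4 * \<eta> * b + d ^ 4) + \<eta> * T)" by simp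
    also have "\<dots> = \<kappa> ^ l * exp (\<eta> * T)"
      unfolding \<kappa>_def exp_add exp_of_nat_mult ..
    finally show "\<omega> \<in> A"
      unfolding A_def T_def end_eq[symmetric] using \<omega> l by (auto intro!: exI[of _ l])
  qed
  show ?thesis
    by (rule bexI[of _ A]) (use sub prob bound in auto)
qed

lemma block_size_bounds:
  fixes N :: nat
  defines "q \<equiv> real N powr (1/3)"
  assumes "2 \<le> q"
  shows "real N = q ^ 3" and "(2 * real N) powr (2/3) + 1 \<le> 2 * q\<^sup>2"
proof -
  have N: "0 < real N" using assms(2) by (cases "N = 0") (auto simp: q_def)
  show "real N = q ^ 3"
    unfolding q_def using N by (simp add: powr_power)
  have L: "(2 * real N) powr (2/3) = 2 powr (2/3) * q\<^sup>2"
    unfolding q_def using N by (simp add: powr_mult powr_power)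
  have "(2 powr (2/3)) ^ 3 = (4::real)" by (simp add: powr_power)
  also have "\<dots> \<le> (8/5) ^ 3" by (simp add: power3_eq_cube)
  finally have "2 powr (2/3) \<le> (8/5 :: real)" by (rule power_le_imp_le_base[of _ 2, unfolded Suc_numeral, simplified]) simp
  then have "2 powr (2/3) * q\<^sup>2 \<le> 8/5 * q\<^sup>2" by (intro mult_right_mono) auto
  moreover have "2\<^sup>2 \<le> q\<^sup>2" using assms(2) by (intro power_mono) auto
  ultimately show "(2 * real N) powr (2/3) + 1 \<le> 2 * q\<^sup>2" unfolding L by simp
qed

text \<open>
  The supremum over \<open>s\<close> need not be attained, since the end point jumps when \<open>s * (2 * N) powr (2/3)\<close>
  reaches an integer. Replacing the parabola by its value at the right end of each interval of constancy
  bounds the supremum by a maximum over finitely many offsets.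
\<close>

lemma lpp_SUP_exceeds:
  fixes w :: "int \<times> int \<Rightarrow> real" and N :: nat
  assumes N: "0 < N" and t: "0 \<le> t" and S: "0 < S"
    and sup: "lev \<le> (SUP s\<in>{0..t}. (lpp_T w N s - 4 * real N + s\<^sup>2 * 2 powr (4/3) * real N powr (1/3)) / S)"
  obtains k where "real k \<le> t * (2 * real N) powr (2/3)"
    and "4 * real N + lev * S \<le> last_passage_time w (0, 0) (int N - int k, int N + int k) + (real k + 1)\<^sup>2 / real N"
proof -
  define L where "L = (2 * real N) powr (2/3)"
  have L: "0 < L" using N by (simp add: L_def)
  define V where "V k = (last_passage_time w (0, 0) (int N - int k, int N + int k) - 4 * real N
      + (real k + 1)\<^sup>2 / real N) / S" for k
  define k\<^sub>0 where "k\<^sub>0 = nat \<lfloor>t * L\<rfloor>"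
  have *: "2 powr (4/3) * real N powr (1/3) = L\<^sup>2 / real N"
  proof -
    have "L\<^sup>2 = (2 * real N) powr (2/3 + 2/3)"
      unfolding L_def power2_eq_square by (rule powr_add[symmetric])
    also have "\<dots> = 2 powr (4/3) * real N powr (4/3)" by (simp add: powr_mult)
    also have "real N powr (4/3) = real N powr (1/3 + 1)" by simp
    also have "\<dots> = real N powr (1/3) * real N" using N by (subst powr_add) simp
    finally show ?thesis using N by simp
  qed
  have "(lpp_T w N s - 4 * real N + s\<^sup>2 * 2 powr (4/3) * real N powr (1/3)) / S \<le> Max (V ` {..k\<^sub>0})"
    if s: "s \<in> {0..t}" for s
  proof -
    define k where "k = nat \<lfloor>s * L\<rfloor>"
    have sL: "0 \<le> s * L" "s * L \<le> t * L" using s L by auto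
    then have k: "int k = \<lfloor>s * L\<rfloor>" by (simp add: k_def)
    have "k \<le> k\<^sub>0" unfolding k_def k\<^sub>0_def using sL by (intro nat_mono floor_mono)
    have "s * L \<le> real k + 1" using k sL by linarith
    then have "(s * L)\<^sup>2 \<le> (real k + 1)\<^sup>2" using sL by (intro power_mono) auto
    then have "(s * L)\<^sup>2 / real N \<le> (real k + 1)\<^sup>2 / real N" by (intro divide_right_mono) auto
    moreover have "s\<^sup>2 * 2 powr (4/3) * real N powr (1/3) = (s * L)\<^sup>2 / real N"
      unfolding mult.assoc * by (simp add: power_mult_distrib)
    moreover have "lpp_T w N s = last_passage_time w (0, 0) (int N - int k, int N + int k)"
      unfolding lpp_T_def lpp_endpoint_def L_def[symmetric] k ..
    ultimately have "(lpp_T w N s - 4 * real N + s\<^sup>2 * 2 powr (4/3) * real N powr (1/3)) / S \<le> V k"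
      unfolding V_def using S by (intro divide_right_mono) auto
    also have "\<dots> \<le> Max (V ` {..k\<^sub>0})" using \<open>k \<le> k\<^sub>0\<close> by (intro Max_ge) auto
    finally show ?thesis .
  qed
  then have "(SUP s\<in>{0..t}. (lpp_T w N s - 4 * real N + s\<^sup>2 * 2 powr (4/3) * real N powr (1/3)) / S) \<le> Max (V ` {..k\<^sub>0})"
    using t by (intro cSUP_least) auto
  then have "lev \<le> Max (V ` {..k\<^sub>0})" using sup by simp
  then obtain k where k: "k \<le> k\<^sub>0" "lev \<le> V k"
    by (subst (asm) Max_ge_iff) auto
  show thesis
  proof (rule that)
    have "real k \<le> real k\<^sub>0" using k by simp
    also have "\<dots> \<le> t * L" using t L by (simp add: k\<^sub>0_def)
    finally show "real k \<le> t * (2 * real N) powr (2/3)" unfolding L_def .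
    show "4 * real N + lev * S \<le> last_passage_time w (0, 0) (int N - int k, int N + int k) + (real k + 1)\<^sup>2 / real N"
      using k(2) S unfolding V_def by (simp add: pos_le_divide_eq)
  qed
qed

text \<open>
  The logarithm of the left hand side is \<open>- 3/2 * \<epsilon> * ln t + O ((ln t) powr (2/3))\<close>.
\<close>

lemma union_bound_asymptotics:
  fixes \<epsilon> \<beta> :: real
  assumes "0 < \<epsilon>" "0 < \<beta>"
  shows "\<forall>\<^sub>F t::real in at_top. (t + 1) * (2 * exp (- (1 + 3/2 * \<epsilon>) * ln t
      + 8 * (\<beta> * ln t powr (1/3))\<^sup>2 + 4 * (\<beta> * ln t powr (1/3)) + 1)) \<le> t powr (- \<epsilon>)"
  using assms by real_asymp

text \<open>
  With \<open>h = \<beta> * ln t powr (1/3)\<close> the exponent \<open>4/3 * h ^ 3 - h * Y\<close> equals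
  \<open>(4/3 * \<beta> ^ 3 - 3/2 * (1 + \<epsilon>)) * ln t\<close> for the threshold \<open>Y\<close> of the theorem
  and \<open>\<beta> = (3/8) powr (1/3)\<close>. This \<open>\<beta>\<close> is optimal for \<open>\<epsilon> = 0\<close>, where the coefficient of \<open>ln t\<close> is then
  exactly \<open>-1\<close>.
\<close>

lemma chernoff_constant:
  "(3/4) powr (2/3) * 2 powr (4/3) * (3/8) powr (1/3) = (3/2 :: real)" "((3/8) powr (1/3)) ^ 3 = (3/8 :: real)"
proof -
  have cubes: "((3/4) powr (2/3)) ^ 3 = (9/16 :: real)" "(2 powr (4/3)) ^ 3 = (16 :: real)"
    "((3/8) powr (1/3)) ^ 3 = (3/8 :: real)"
    by (simp_all add: powr_power power2_eq_square)
  have "((3/4) powr (2/3) * 2 powr (4/3) * (3/8) powr (1/3)) ^ 3 = ((3/2) ^ 3 :: real)"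
    unfolding power_mult_distrib cubes by (simp add: power3_eq_cube)
  then show "(3/4) powr (2/3) * 2 powr (4/3) * (3/8) powr (1/3) = (3/2 :: real)"
    by (rule power_eq_imp_eq_base) auto
  show "((3/8) powr (1/3)) ^ 3 = (3/8 :: real)" by (simp add: powr_power)
qed

theorem theorem3p1:
  fixes M :: "'a measure" and X :: "int \<times> int \<Rightarrow> 'a \<Rightarrow> real" and \<epsilon> :: real
  assumes "prob_space M"
    and "iid_exp1_weights M X"
    and "\<epsilon> > 0"
  shows "\<exists>\<gamma>>0. \<forall>\<^sub>F t::real in at_top. \<forall>\<^sub>F N::nat in sequentially.
           \<P>(\<omega> in M.
              (SUP s\<in>{0..t}.
                 (lpp_T (\<lambda>v. X v \<omega>) N s - 4 * real N
                    + s\<^sup>2 * 2 powr (4/3) * real N powr (1/3))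
                 / (2 powr (4/3) * real N powr (1/3) * ln t powr (2/3)))
              \<ge> (3/4) powr (2/3) * (1 + \<epsilon>))
           \<le> t powr (- \<gamma>)"
proof (intro exI[of _ \<epsilon>] conjI)
  interpret prob_space M by fact
  define \<beta> where "\<beta> = (3/8) powr (1/3 :: real)"
  have \<beta>: "0 < \<beta>" by (simp add: \<beta>_def)
  have "\<forall>\<^sub>F t::real in at_top. 1 < t \<and> (t + 1) * (2 * exp (- (1 + 3/2 * \<epsilon>) * ln t
      + 8 * (\<beta> * ln t powr (1/3))\<^sup>2 + 4 * (\<beta> * ln t powr (1/3)) + 1)) \<le> t powr (- \<epsilon>)"
    by (intro eventually_conj eventually_gt_at_top union_bound_asymptotics assms \<beta>)
  then show "\<forall>\<^sub>F t::real in at_top. \<forall>\<^sub>F N::nat in sequentially.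
           \<P>(\<omega> in M.
              (SUP s\<in>{0..t}.
                 (lpp_T (\<lambda>v. X v \<omega>) N s - 4 * real N
                    + s\<^sup>2 * 2 powr (4/3) * real N powr (1/3))
                 / (2 powr (4/3) * real N powr (1/3) * ln t powr (2/3)))
              \<ge> (3/4) powr (2/3) * (1 + \<epsilon>))
           \<le> t powr (- \<epsilon>)"
  proof eventually_elim
    case (elim t)
    then have t: "1 < t" and final: "(t + 1) * (2 * exp (- (1 + 3/2 * \<epsilon>) * ln t
      + 8 * (\<beta> * ln t powr (1/3))\<^sup>2 + 4 * (\<beta> * ln t powr (1/3)) + 1)) \<le> t powr (- \<epsilon>)" by auto
    define h where "h = \<beta> * ln t powr (1/3)"
    define Y where "Y = (3/4) powr (2/3) * (1 + \<epsilon>) * 2 powr (4/3) * ln t powr (2/3)"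
    \<comment> \<open>A block starts at offset \<open>i * K\<close> with \<open>i \<le> t\<close> and \<open>K \<le> 2 * q\<^sup>2\<close>.\<close>
    define C where "C = 2 * t"
    have h: "0 < h" using \<beta> t by (simp add: h_def)
    have exponent: "4/3 * h ^ 3 - h * Y = - (1 + 3/2 * \<epsilon>) * ln t"
    proof -
      have "(ln t powr (1/3)) ^ 3 = ln t" using t by (simp add: powr_power)
      then have "h ^ 3 = 3/8 * ln t"
        unfolding h_def power_mult_distrib \<beta>_def chernoff_constant(2) by simp
      moreover have "h * Y = 3/2 * (1 + \<epsilon>) * ln t"
      proof -
        have "ln t powr (1/3) * ln t powr (2/3) = ln t" using t by (simp flip: powr_add)
        moreover have "h * Y = ((3/4) powr (2/3) * 2 powr (4/3) * \<beta>) * (1 + \<epsilon>) * (ln t powr (1/3) * ln t powr (2/3))"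
          by (simp add: h_def Y_def)
        ultimately show ?thesis unfolding \<beta>_def chernoff_constant(1) by simp
      qed
      ultimately show ?thesis by (simp add: algebra_simps)
    qed
    define B where "B = max 2 (max (10 * (h + C / 2)) (max (C + 2) (2 * h * C + 1250 * (h + C / 2) ^ 4
        + 4 * h + 4/3 * h ^ 3 + h * C\<^sup>2 + 8 * (h + C / 2) ^ 5 + 2 * C * (h + C / 2) ^ 4)))"
    have "filterlim (\<lambda>N::nat. real N powr (1/3)) at_top sequentially" by real_asymp
    then have "\<forall>\<^sub>F N in sequentially. B \<le> real N powr (1/3)"
      by (simp add: filterlim_at_top)
    then show ?case
    proof eventually_elim
      case (elim N)
      define q where "q = real N powr (1/3)"
      have q: "2 \<le> q" "10 * (h + C / 2) \<le> q" "C + 2 \<le> q" "2 * h * C + 1250 * (h + C / 2) ^ 4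
        + 4 * h + 4/3 * h ^ 3 + h * C\<^sup>2 + 8 * (h + C / 2) ^ 5 + 2 * C * (h + C / 2) ^ 4 \<le> q"
        using elim by (auto simp: B_def q_def)
      then have N: "0 < N" by (cases "N = 0") (auto simp: q_def)
      note size = block_size_bounds[of N, folded q_def, OF q(1)]
      define L where "L = (2 * real N) powr (2/3)"
      have L: "0 < L" using N by (simp add: L_def)
      define K where "K = nat \<lceil>L\<rceil>"
      have K: "1 \<le> K" "L \<le> real K" "real K \<le> 2 * q\<^sup>2"
        using L size(2) unfolding L_def[symmetric] K_def by linarith+
      define blk where "blk k = {\<omega>\<in>space M. \<exists>l<K. 4 * real N + Y * q \<le>
            last_passage_time (\<lambda>v. X v \<omega>) (0, 0) (int N - int (k + l), int N + int (k + l))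
              + (real (k + l) + 1)\<^sup>2 / real N}" for k
      define bound where "bound = 2 * exp (4/3 * h ^ 3 - h * Y + 8 * h\<^sup>2 + 4 * h + 1)"
      have "\<exists>A\<in>sets M. blk (i * K) \<subseteq> A \<and> measure M A \<le> bound" if "i \<le> nat \<lfloor>t\<rfloor>" for i
        unfolding blk_def bound_def
      proof (rule prob_block_le[OF assms(1,2) size(1) h _ K(1,3) _ q(2-4)])
        have "real (i * K) \<le> t * (2 * q\<^sup>2)"
        proof -
          have "real i \<le> t" using that t by linarith
          then show ?thesis unfolding of_nat_mult using t K(3) by (intro mult_mono) auto
        qed
        then show "real (i * K) \<le> C * q\<^sup>2" by (simp add: C_def)
      qed (use q in simp)
      then obtain A where A: "A i \<in> sets M" "blk (i * K) \<subseteq> A i" "measure M (A i) \<le> bound"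
        if "i \<le> nat \<lfloor>t\<rfloor>" for i
        by metis
      define ev where "ev = {\<omega>\<in>space M. (3/4) powr (2/3) * (1 + \<epsilon>) \<le>
              (SUP s\<in>{0..t}.
                 (lpp_T (\<lambda>v. X v \<omega>) N s - 4 * real N
                    + s\<^sup>2 * 2 powr (4/3) * real N powr (1/3))
                 / (2 powr (4/3) * real N powr (1/3) * ln t powr (2/3)))}"
      have "ev \<subseteq> (\<Union>i\<le>nat \<lfloor>t\<rfloor>. A i)"
      proof
        fix \<omega> assume "\<omega> \<in> ev"
        then have \<omega>: "\<omega> \<in> space M" and sup: "(3/4) powr (2/3) * (1 + \<epsilon>) \<le>
              (SUP s\<in>{0..t}.
                 (lpp_T (\<lambda>v. X v \<omega>) N s - 4 * real N
                    + s\<^sup>2 * 2 powr (4/3) * real N powr (1/3))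
                 / (2 powr (4/3) * real N powr (1/3) * ln t powr (2/3)))"
          by (auto simp: ev_def)
        have "0 < 2 powr (4/3) * real N powr (1/3) * ln t powr (2/3)" using N t by simp
        from lpp_SUP_exceeds[OF N _ this sup] t
        obtain k where k: "real k \<le> t * L" "4 * real N
              + (3/4) powr (2/3) * (1 + \<epsilon>) * (2 powr (4/3) * real N powr (1/3) * ln t powr (2/3))
            \<le> last_passage_time (\<lambda>v. X v \<omega>) (0, 0) (int N - int k, int N + int k) + (real k + 1)\<^sup>2 / real N"
          unfolding L_def by auto
        have Yq: "(3/4) powr (2/3) * (1 + \<epsilon>) * (2 powr (4/3) * real N powr (1/3) * ln t powr (2/3)) = Y * q"
          by (simp add: Y_def q_def)
        define i l where "i = k div K" and "l = k mod K"
        have kil: "k = i * K + l" "l < K" using K(1) by (auto simp: i_def l_def)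
        have "real i * real K \<le> real k" unfolding kil(1) by simp
        also have "\<dots> \<le> t * real K" using k(1) K(2) t by (meson mult_left_mono order_trans less_imp_le zero_less_one)
        finally have "real i \<le> t" using K(1) by simp
        then have i: "i \<le> nat \<lfloor>t\<rfloor>" by (simp add: le_nat_floor)
        have "\<omega> \<in> blk (i * K)"
          unfolding blk_def
        proof (intro CollectI conjI exI)
          show "4 * real N + Y * q \<le>
              last_passage_time (\<lambda>v. X v \<omega>) (0, 0) (int N - int (i * K + l), int N + int (i * K + l))
                + (real (i * K + l) + 1)\<^sup>2 / real N"
            using k(2) unfolding Yq kil(1)[symmetric] .
        qed (rule \<omega> kil(2))+
        then show "\<omega> \<in> (\<Union>i\<le>nat \<lfloor>t\<rfloor>. A i)" using A(2)[OF i] i by blast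
      qed
      then have "measure M ev \<le> measure M (\<Union>i\<le>nat \<lfloor>t\<rfloor>. A i)"
        using A(1) by (intro finite_measure_mono) auto
      also have "\<dots> \<le> (\<Sum>i\<le>nat \<lfloor>t\<rfloor>. measure M (A i))"
        using A(1) by (intro finite_measure_subadditive_finite) auto
      also have "\<dots> \<le> (\<Sum>i\<le>nat \<lfloor>t\<rfloor>. bound)"
        using A(3) by (intro sum_mono) auto
      also have "\<dots> = (real (nat \<lfloor>t\<rfloor>) + 1) * bound" by (simp add: algebra_simps)
      also have "\<dots> \<le> (t + 1) * bound"
        using t by (intro mult_right_mono) (auto simp: bound_def)
      also have "\<dots> \<le> t powr (- \<epsilon>)"
        using final[folded h_def] unfolding bound_def exponent .
      finally show ?case unfolding ev_def .
    qed
  qed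
qed (use assms in simp)

end
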